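(* Let $p\ge1$, let $g_2,\dots,g_{2p}$ be real with $g_{2p}>0$, $V(\lambda)=\sum_{j=1}^pg_{2j}\lambda^j$, $V_\lambda=dV/d\lambda$. Let $r_{\mathrm c}>0$ and $w_{\mathrm c}(\lambda)=\sqrt{\lambda(\lambda-4r_{\mathrm c})}$ (branch analytic in $|\lambda|>4r_{\mathrm c}$ with $w_{\mathrm c}\sim\lambda$ at infinity), and write $\oint$ for $\oint_{|\lambda|=R}\frac{d\lambda}{2\pi i}$ with $R>4r_{\mathrm c}$, positively oriented. Let $m\ge1$ and assume $$\oint\frac{V_\lambda}{w_{\mathrm c}}=0,\qquad \oint\frac{(\lambda-4r_{\mathrm c})^{k+1}V_\lambda}{w_{\mathrm c}^{2k+1}}=0\ (k=1,\dots,m-1),$$ $$\varphi_m:=\oint\frac{(\lambda-4r_{\mathrm c})^{m+1}V_\lambda}{w_{\mathrm c}^{2m+1}}\neq0,\qquad \oint\frac{\lambda^2V_\lambda}{w_{\mathrm c}^{3}}\neq0,$$ and set $T_{\mathrm c}=\oint\lambda V_\lambda/w_{\mathrm c}$. Let $I\subset\mathbb{R}$ be an open interval and let $\mathfrak a(\bar\epsilon,x)=r_{\mathrm c}+\sum_{k\ge1}\mathfrak a_k(x)\bar\epsilon^k$ and $\mathbb V(\lambda,\bar\epsilon;x)=\sum_{k\ge0}\mathbb V^{[k]}(\lambda,x)\bar\epsilon^k$ be formal power series in $\bar\epsilon$, with $\mathfrak a_k\in C^\infty(I)$, each $\mathbb V^{[k]}$ analytic in $\lambda$ for $|\lambda|>4r_{\mathrm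 c}$ and $C^\infty$ in $x$, and $\mathbb V^{[0]}=\lambda/w_{\mathrm c}$, such that, as formal power series in $\bar\epsilon$ and for all $x\in I$, $$\mathfrak a(\bar\epsilon,x)\big(\mathbb V(\lambda,\bar\epsilon;x)+\mathbb V(\lambda,-\bar\epsilon;x-\bar\epsilon)\big)\big(\mathbb V(\lambda,\bar\epsilon;x)+\mathbb V(\lambda,-\bar\epsilon;x+\bar\epsilon)\big)=\lambda\big(\mathbb V(\lambda,\bar\epsilon;x)^2-1\big)$$ and $$\oint V_\lambda(\lambda)\,\mathbb V(\lambda,\bar\epsilon;x)=T_{\mathrm c}+\bar\epsilon^{2m}x.$$ Then $u=\mathfrak a_1$ satisfies on $I$ the ordinary differential equation $$2r_{\mathrm c}\,\varphi_m\,R_m(u)+x\,u=0,$$ where the differential polynomials $R_j,S_j$ in $u$ are defined by $$R_0=-\frac{u}{2r_{\mathrm c}},\qquad S_0=-\frac{u^2}{8r_{\mathrm c}^2},\qquad R_{j+1}=-r_{\mathrm c}\,\partial_x^2R_j+2u\,S_j,\qquad 2r_{\mathrm c}\,\partial_xS_{j+1}=u\,\partial_xR_{j+1},$$ with $S_{j+1}$ taken without constant term.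
   Context: Shifted and sign-reversed series are understood formally: for $F(\bar\epsilon;x)=\sum_kF_k(x)\bar\epsilon^k$ and constants $c$, $F(\pm\bar\epsilon;x+c\bar\epsilon)=\sum_{k,n}(\pm1)^kF_k^{(n)}(x)c^n\bar\epsilon^{k+n}/n!$; equalities of formal series mean equality of coefficients of each power of $\bar\epsilon$. The contour integral over a large positively oriented circle equals the coefficient of $\lambda^{-1}$ in the expansion at $\lambda=\infty$. The hypotheses on the contour integrals express that the potential $V/T_{\mathrm c}$ is a critical model with a merging of two cuts of order $m$, and $(\mathfrak a,\mathbb V)$ describes a symmetric solution of the double-scaled string equations. The equation $2r_{\mathrm c}\varphi_mR_m(u)+xu=0$ is the $m$-th member of the Painlevé II hierarchy (for $m=1$: $R_1=\tfrac12u_{xx}-u^3/(4r_{\mathrm c}^2)$). *)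

theory Defs
  imports "HOL-Complex_Analysis.Complex_Analysis" "HOL-Library.Poly_Mapping"
    "HOL-Computational_Algebra.Formal_Power_Series"
begin

definition cint :: "real \<Rightarrow> (complex \<Rightarrow> complex) \<Rightarrow> complex" where
  "cint R f = contour_integral (circlepath 0 R) f / (2 * of_real pi * \<i>)"

(* w_c(z) = sqrt(z (z - 4 r)), branch analytic in |z| > 4r with w_c ~ z at infinity *)
definition wc :: "real \<Rightarrow> complex \<Rightarrow> complex" where
  "wc r z = z * csqrt (1 - 4 * of_real r / z)"

definition Vpot :: "(nat \<Rightarrow> real) \<Rightarrow> nat \<Rightarrow> complex \<Rightarrow> complex" where
  "Vpot g p z = (\<Sum>j=1..p. of_real (g (2*j)) * z ^ j)"

definition dnx :: "nat \<Rightarrow> (real \<Rightarrow> 'a::real_normed_vector) \<Rightarrow> real \<Rightarrow> 'a" where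
  "dnx n f = ((\<lambda>h x. vector_derivative h (at x)) ^^ n) f"

definition Cinf_on :: "real set \<Rightarrow> (real \<Rightarrow> 'a::real_normed_vector) \<Rightarrow> bool" where
  "Cinf_on I f \<longleftrightarrow> (\<forall>n. \<forall>x\<in>I. dnx n f differentiable (at x))"

(* coefficient of e^N in the formal series F(s e; x + c e), F(e;x) = sum_k F k x e^k *)
definition shift_coeff :: "real \<Rightarrow> real \<Rightarrow> (nat \<Rightarrow> real \<Rightarrow> complex) \<Rightarrow> nat \<Rightarrow> real \<Rightarrow> complex" where
  "shift_coeff s c F N x = (\<Sum>n\<le>N. of_real (s ^ (N - n) * c ^ n / fact n) * dnx n (F (N - n)) x)"

(* differential polynomials in u: polynomials in the jet variables u, u', u'', ...;
   variable i stands for the i-th x-derivative of u *)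
type_synonym dpoly = "(nat \<Rightarrow>\<^sub>0 nat) \<Rightarrow>\<^sub>0 real"

definition dvar :: "nat \<Rightarrow> dpoly" where
  "dvar i = Poly_Mapping.single (Poly_Mapping.single i 1) 1"

definition dconst :: "real \<Rightarrow> dpoly" where
  "dconst c = Poly_Mapping.single 0 c"

definition dmono_deriv :: "(nat \<Rightarrow>\<^sub>0 nat) \<Rightarrow> dpoly" where
  "dmono_deriv \<alpha> = (\<Sum>i\<in>Poly_Mapping.keys \<alpha>.
      Poly_Mapping.single (\<alpha> - Poly_Mapping.single i 1 + Poly_Mapping.single (Suc i) 1)
        (of_nat (Poly_Mapping.lookup \<alpha> i)))"

definition dD :: "dpoly \<Rightarrow> dpoly" where
  "dD P = (\<Sum>\<alpha>\<in>Poly_Mapping.keys P. dconst (Poly_Mapping.lookup P \<alpha>) * dmono_deriv \<alpha>)"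

definition deval :: "dpoly \<Rightarrow> (real \<Rightarrow> real) \<Rightarrow> real \<Rightarrow> real" where
  "deval P u x = (\<Sum>\<alpha>\<in>Poly_Mapping.keys P. Poly_Mapping.lookup P \<alpha> * (\<Prod>i\<in>Poly_Mapping.keys \<alpha>. dnx i u x ^ Poly_Mapping.lookup \<alpha> i))"

fun RS :: "real \<Rightarrow> nat \<Rightarrow> dpoly \<times> dpoly" where
  "RS r 0 = (dconst (- 1 / (2 * r)) * dvar 0, dconst (- 1 / (8 * r ^ 2)) * dvar 0 ^ 2)"
| "RS r (Suc j) =
     (let Rn = - (dconst r * dD (dD (fst (RS r j)))) + 2 * dvar 0 * snd (RS r j)
      in (Rn, THE S. dconst (2 * r) * dD S = dvar 0 * dD Rn \<and> Poly_Mapping.lookup S 0 = 0))"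

definition Rpoly :: "real \<Rightarrow> nat \<Rightarrow> dpoly" where
  "Rpoly r j = fst (RS r j)"

end

theory Submission
  imports Defs
begin

text \<open>
  Put \<open>y = 1/z\<close> and \<open>W = V w\<^sub>c/z\<close>, so that the quadratic equation becomes
  \<open>y a (W + W\<^sup>-) (W + W\<^sup>+) = W\<^sup>2 - 1 + 4 r\<^sub>c y\<close>. Solving it order by order in the deformation parameter,
  the coefficient \<open>W\<^sub>N\<close> is a polynomial in \<open>y\<close> of degree at most \<open>(N + 1) div 2\<close> as long as \<open>N < 2m\<close>:
  at even orders one divides by \<open>1 - 4 r\<^sub>c y\<close>, and the remainder is killed by the string equation because
  the edge moment does not vanish. The top coefficients of \<open>W\<^sub>2\<^sub>j\<close> and \<open>W\<^sub>2\<^sub>j\<^sub>+\<^sub>1\<close> depend only on \<open>u\<close>; they are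
  \<open>\<sigma>\<^sub>j\<close> and \<open>\<rho>\<^sub>j\<close> with \<open>\<rho>\<^sub>j = -4 r\<^sub>c R\<^sub>j\<close>, \<open>\<sigma>\<^sub>0 = 1\<close>, \<open>\<sigma>\<^sub>j\<^sub>+\<^sub>1 = -4 r\<^sub>c S\<^sub>j\<close>.
  At order \<open>2m\<close> the remainder is proportional to \<open>x\<close>, and at order \<open>2m + 1\<close> the moments of \<open>y\<^sup>k\<close>, \<open>k < m\<close>,
  vanish, so that the string equation relates the top coefficient \<open>\<rho>\<^sub>m\<close> to the remainder times \<open>u\<close>,
  which is the claimed equation.

  That the recursion for \<open>R\<^sub>j, S\<^sub>j\<close> is solvable in differential polynomials follows from the first
  integral \<open>r\<^sub>c (4 \<sigma>\<^sup>2 - t\<^sup>2 (\<partial>\<rho>)\<^sup>2) = t \<rho>\<^sup>2 + 4 r\<^sub>c\<close> of the generating series, which determines \<open>\<sigma>\<close> algebraically.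
\<close>

subsection \<open>Differential polynomials\<close>

abbreviation (input) lookup where "lookup \<equiv> Poly_Mapping.lookup"
abbreviation (input) single where "single \<equiv> Poly_Mapping.single"

lemma dconst_add: "dconst (a + b) = dconst a + dconst b"
  by (simp add: dconst_def single_add)

lemma dconst_mult: "dconst (a * b) = dconst a * dconst b"
  by (simp add: dconst_def mult_single)

lemma dconst_minus: "dconst (- a) = - dconst a"
  by (simp add: dconst_def single_uminus)

lemma dconst_0 [simp]: "dconst 0 = 0"
  by (simp add: dconst_def)

lemma dconst_1 [simp]: "dconst 1 = 1"
  by (simp add: dconst_def)

lemma dconst_numeral [simp]: "dconst (numeral n) = numeral n"
  by (simp add: dconst_def)

lemma single_as_product:
  fixes \<alpha> :: "nat \<Rightarrow>\<^sub>0 nat"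
  shows "single \<alpha> c = dconst c * single \<alpha> 1"
  by (simp add: dconst_def mult_single)

lemma single_dvar_power: "single (single i n) 1 = dvar i ^ n"
proof (induction n)
  case (Suc n)
  have "single (single i (Suc n)) (1::real) = single (single i 1 + single i n) 1"
    by (simp flip: single_add)
  also have "\<dots> = dvar i * single (single i n) 1"
    by (simp add: dvar_def mult_single)
  finally show ?case using Suc by simp
qed simp

section \<open>Monomial expansion and induction over the generators\<close>

lemma dpoly_single_sum: "(P::dpoly) = (\<Sum>\<alpha>\<in>Poly_Mapping.keys P. single \<alpha> (lookup P \<alpha>))"
proof (rule poly_mapping_eqI)
  fix k
  have "(\<Sum>\<alpha>\<in>Poly_Mapping.keys P. lookup (single \<alpha> (lookup P \<alpha>)) k)
      = (\<Sum>\<alpha>\<in>Poly_Mapping.keys P. if \<alpha> = k then lookup P \<alpha> else 0)"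
    by (intro sum.cong) (auto simp: lookup_single when_def)
  then show "lookup P k = lookup (\<Sum>\<alpha>\<in>Poly_Mapping.keys P. single \<alpha> (lookup P \<alpha>)) k"
    by (simp add: lookup_sum in_keys_iff)
qed

text \<open>Constants and jet variables generate the ring \<open>dpoly\<close>, so a property stable
  under sums and products need only be checked on them. Monomials are built up one variable at a
  time.\<close>

lemma dpoly_induct [case_names const var add mult]:
  assumes c: "\<And>c. Q (dconst c)" and v: "\<And>i. Q (dvar i)"
    and a: "\<And>p q. Q p \<Longrightarrow> Q q \<Longrightarrow> Q (p + q)" and m: "\<And>p q. Q p \<Longrightarrow> Q q \<Longrightarrow> Q (p * q)"
  shows "Q P"
proof -
  have pow: "Q (dvar i ^ n)" for i n
    by (induction n) (use c[of 1] m v in auto)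
  have mono: "Q (single \<alpha> 1)" for \<alpha>
  proof (induction \<alpha> rule: update_induct)
    case const
    then show ?case using c[of 1] by simp
  next
    case (update f i n)
    have "Poly_Mapping.update i n f = single i n + f"
      by (rule poly_mapping_eqI)
         (use update(1) in \<open>auto simp: lookup_update lookup_add lookup_single when_def in_keys_iff\<close>)
    then have "single (Poly_Mapping.update i n f) 1 = dvar i ^ n * single f 1"
      by (simp add: mult_single flip: single_dvar_power)
    then show ?case using update pow m by simp
  qed
  have "Q (sum (\<lambda>\<alpha>. single \<alpha> (lookup P \<alpha>)) A)" if "finite A" for A
    using that
  proof (induction A rule: finite_induct)
    case empty then show ?case using c[of 0] by simp
  next
    case (insert \<alpha> A)
    then show ?case using a m[OF c mono] by (simp, subst single_as_product) blast
  qed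
  then show ?thesis by (subst dpoly_single_sum) simp
qed

section \<open>The total derivative is a derivation\<close>

lemma dmono_deriv_superset:
  assumes "finite K" "Poly_Mapping.keys \<alpha> \<subseteq> K"
  shows "dmono_deriv \<alpha> = (\<Sum>i\<in>K. single (\<alpha> - single i 1 + single (Suc i) 1) (of_nat (lookup \<alpha> i)))"
  unfolding dmono_deriv_def
  by (rule sum.mono_neutral_left) (use assms in \<open>auto simp: in_keys_iff\<close>)

text \<open>Absent keys contribute zero, so sums over different key sets can all be taken over their
  union and then compared term by term.\<close>

lemma dD_superset:
  assumes "finite K" "Poly_Mapping.keys P \<subseteq> K"
  shows "dD P = (\<Sum>\<alpha>\<in>K. dconst (lookup P \<alpha>) * dmono_deriv \<alpha>)"
  unfolding dD_def
  by (rule sum.mono_neutral_left) (use assms in \<open>auto simp: in_keys_iff\<close>)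

lemma dD_add: "dD (P + Q) = dD P + dD Q"
proof -
  let ?K = "Poly_Mapping.keys P \<union> Poly_Mapping.keys Q"
  have K: "finite ?K" "Poly_Mapping.keys P \<subseteq> ?K" "Poly_Mapping.keys Q \<subseteq> ?K"
    "Poly_Mapping.keys (P + Q) \<subseteq> ?K"
    using keys_add[of P Q] by auto
  show ?thesis
    unfolding dD_superset[OF K(1,2)] dD_superset[OF K(1,3)] dD_superset[OF K(1,4)]
    by (simp add: lookup_add dconst_add algebra_simps sum.distrib)
qed

lemma dD_0 [simp]: "dD 0 = 0"
  by (simp add: dD_def)

lemma dD_single: "dD (single \<alpha> c) = dconst c * dmono_deriv \<alpha>"
  by (subst dD_superset[of "{\<alpha>}"]) auto

lemma dD_minus: "dD (- P) = - dD P"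
  using dD_add[of P "-P"] by (simp add: eq_neg_iff_add_eq_0 add.commute)

lemma dD_sum: "dD (sum f A) = (\<Sum>i\<in>A. dD (f i))"
  by (induction A rule: infinite_finite_induct) (auto simp: dD_add)

text \<open>The Leibniz rule, compared variable by variable. Subtraction of exponents is truncated,
  so it is moved onto a factor only if the variable occurs there; otherwise the coefficient is zero
  and the malformed exponent is harmless.\<close>

lemma dmono_deriv_add:
  "dmono_deriv (\<alpha> + \<beta>) = single \<alpha> 1 * dmono_deriv \<beta> + dmono_deriv \<alpha> * single \<beta> 1"
proof -
  let ?K = "Poly_Mapping.keys \<alpha> \<union> Poly_Mapping.keys \<beta>"
  have K: "finite ?K" "Poly_Mapping.keys \<alpha> \<subseteq> ?K" "Poly_Mapping.keys \<beta> \<subseteq> ?K"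
    "Poly_Mapping.keys (\<alpha> + \<beta>) \<subseteq> ?K"
    using keys_add[of \<alpha> \<beta>] by auto
  have *: "single (\<alpha> + \<beta> - single i 1 + single (Suc i) 1) (of_nat (lookup (\<alpha> + \<beta>) i))
     = single \<alpha> 1 * single (\<beta> - single i 1 + single (Suc i) 1) (of_nat (lookup \<beta> i))
       + single (\<alpha> - single i 1 + single (Suc i) 1) (of_nat (lookup \<alpha> i)) * (single \<beta> 1 :: dpoly)" for i
  proof -
    have 1: "\<alpha> + \<beta> - single i 1 = \<alpha> + (\<beta> - single i 1)" if "lookup \<beta> i \<noteq> 0"
      by (rule poly_mapping_eqI) (use that in \<open>auto simp: lookup_add lookup_minus lookup_single when_def\<close>)
    have 2: "\<alpha> + \<beta> - single i 1 = (\<alpha> - single i 1) + \<beta>" if "lookup \<alpha> i \<noteq> 0"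
      by (rule poly_mapping_eqI) (use that in \<open>auto simp: lookup_add lookup_minus lookup_single when_def\<close>)
    consider "lookup \<alpha> i = 0" "lookup \<beta> i = 0" | "lookup \<alpha> i = 0" "lookup \<beta> i \<noteq> 0"
      | "lookup \<alpha> i \<noteq> 0" "lookup \<beta> i = 0" | "lookup \<alpha> i \<noteq> 0" "lookup \<beta> i \<noteq> 0" by blast
    then show ?thesis
    proof cases
      case 4
      have "single (\<alpha> + \<beta> - single i 1 + single (Suc i) 1) (of_nat (lookup (\<alpha> + \<beta>) i) :: real)
        = single (\<alpha> + \<beta> - single i 1 + single (Suc i) 1) (of_nat (lookup \<beta> i))
          + single (\<alpha> + \<beta> - single i 1 + single (Suc i) 1) (of_nat (lookup \<alpha> i))"
        by (simp add: lookup_add single_add add.commute)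
      also have "single (\<alpha> + \<beta> - single i 1 + single (Suc i) 1) (of_nat (lookup \<beta> i) :: real)
          = single \<alpha> 1 * single (\<beta> - single i 1 + single (Suc i) 1) (of_nat (lookup \<beta> i))"
        unfolding 1[OF 4(2)] mult_single by (simp add: add_ac)
      also have "single (\<alpha> + \<beta> - single i 1 + single (Suc i) 1) (of_nat (lookup \<alpha> i) :: real)
          = single (\<alpha> - single i 1 + single (Suc i) 1) (of_nat (lookup \<alpha> i)) * single \<beta> 1"
        unfolding 2[OF 4(1)] mult_single by (simp add: add_ac)
      finally show ?thesis .
    next
      case 2
      then show ?thesis unfolding 1[OF 2(2)] mult_single by (simp add: lookup_add add_ac)
    next
      case 3
      then show ?thesis unfolding 2[OF 3(1)] mult_single by (simp add: lookup_add add_ac)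
    qed (simp add: lookup_add)
  qed
  show ?thesis
    unfolding dmono_deriv_superset[OF K(1,2)] dmono_deriv_superset[OF K(1,3)]
      dmono_deriv_superset[OF K(1,4)]
    by (simp only: * sum.distrib sum_distrib_left sum_distrib_right)
qed

lemma dD_mult: "dD (P * Q) = P * dD Q + dD P * Q"
proof -
  have *: "dD (single \<alpha> c * single \<beta> d) = single \<alpha> c * dD (single \<beta> d) + dD (single \<alpha> c) * single \<beta> d" for \<alpha> \<beta> c d
    unfolding mult_single dD_single dmono_deriv_add dconst_mult
    by (subst single_as_product[of \<alpha> c], subst single_as_product[of \<beta> d]) (simp add: algebra_simps)
  have "dD ((\<Sum>\<alpha>\<in>A. single \<alpha> (c \<alpha>)) * (\<Sum>\<beta>\<in>B. single \<beta> (d \<beta>)))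
     = (\<Sum>\<alpha>\<in>A. single \<alpha> (c \<alpha>)) * dD (\<Sum>\<beta>\<in>B. single \<beta> (d \<beta>))
       + dD (\<Sum>\<alpha>\<in>A. single \<alpha> (c \<alpha>)) * (\<Sum>\<beta>\<in>B. single \<beta> (d \<beta>))" for A B c d
    by (simp only: sum_product dD_sum * sum.distrib)
  from this[where A = "Poly_Mapping.keys P" and c = "lookup P" and B = "Poly_Mapping.keys Q" and d = "lookup Q"]
  show ?thesis
    by (simp only: dpoly_single_sum[symmetric])
qed

lemma dD_dconst [simp]: "dD (dconst c) = 0"
  unfolding dconst_def by (simp add: dD_single dmono_deriv_def)

lemma dD_dvar [simp]: "dD (dvar i) = dvar (Suc i)"
  by (simp add: dvar_def dD_single dmono_deriv_def)

text \<open>If \<open>n\<close> is the highest jet variable occurring in \<open>S\<close>, then \<open>u\<^sub>n\<^sub>+\<^sub>1\<close> occurs in \<open>dD S\<close> linearly,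
  with coefficient \<open>\<partial>S/\<partial>u\<^sub>n \<noteq> 0\<close>.\<close>
lemma dD_eq_0_imp_const:
  assumes "dD S = 0"
  shows "S = dconst (lookup S 0)"
proof (rule ccontr)
  assume neq: "S \<noteq> dconst (lookup S 0)"
  define V where "V = (\<Union>\<alpha>\<in>Poly_Mapping.keys S. Poly_Mapping.keys \<alpha>)"
  have finV: "finite V" by (simp add: V_def)
  have "V \<noteq> {}"
  proof
    assume "V = {}"
    then have "\<alpha> = 0" if "\<alpha> \<in> Poly_Mapping.keys S" for \<alpha>
      using that unfolding V_def
      by (metis UN_I all_not_in_conv poly_mapping_eqI lookup_zero in_keys_iff)
    then have "lookup S k = lookup (dconst (lookup S 0)) k" for k
      by (auto simp: dconst_def lookup_single when_def in_keys_iff)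
    then show False using neq poly_mapping_eqI by blast
  qed
  define n where "n = Max V"
  have "n \<in> V" and nmax: "\<And>i. i \<in> V \<Longrightarrow> i \<le> n"
    using \<open>V \<noteq> {}\<close> finV by (auto simp: n_def)
  then obtain \<alpha> where \<alpha>: "\<alpha> \<in> Poly_Mapping.keys S" "lookup \<alpha> n \<noteq> 0"
    by (auto simp: V_def in_keys_iff)
  \<comment> \<open>The monomial at which coefficients are compared: one factor u_n of \<alpha> is
    replaced by u_(n+1). No monomial of \<open>S\<close> contains u_(n+1), so \<beta> arises only by
    differentiating u_n, and this determines \<alpha>.\<close>
  define \<beta> where "\<beta> = \<alpha> - single n 1 + single (Suc n) 1"
  have zero: "lookup \<gamma> i = 0" if "\<gamma> \<in> Poly_Mapping.keys S" "i > n" for \<gamma> i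
    using nmax[of i] that unfolding V_def by (force simp: in_keys_iff)
  have \<beta>Suc: "lookup \<beta> (Suc n) = 1"
    using zero[OF \<alpha>(1), of "Suc n"] by (simp add: \<beta>_def lookup_add lookup_minus lookup_single)
  have summand: "lookup (single (\<gamma> - single i 1 + single (Suc i) 1) (of_nat (lookup \<gamma> i))) \<beta>
      = (if \<gamma> = \<alpha> \<and> i = n then of_nat (lookup \<alpha> n) else 0 :: real)"
    if \<gamma>: "\<gamma> \<in> Poly_Mapping.keys S" "i \<in> Poly_Mapping.keys \<gamma>" for \<gamma> i
  proof (cases "\<gamma> - single i 1 + single (Suc i) 1 = \<beta>")
    case True
    then have "lookup (\<gamma> - single i 1 + single (Suc i) 1) (Suc n) = 1" using \<beta>Suc by simp
    then have i: "i = n"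
      using zero[OF \<gamma>(1), of "Suc n"]
      by (auto simp: lookup_add lookup_minus lookup_single when_def split: if_splits)
    have eq: "lookup (\<gamma> - single n 1 + single (Suc n) 1) k = lookup (\<alpha> - single n 1 + single (Suc n) 1) k" for k
      using True unfolding i \<beta>_def by simp
    have "lookup \<gamma> k = lookup \<alpha> k" for k
      using eq[of k] \<alpha>(2) \<gamma>(2) i
      by (cases "k = n") (auto simp: lookup_add lookup_minus lookup_single when_def in_keys_iff)
    then have "\<gamma> = \<alpha>" by (rule poly_mapping_eqI)
    then show ?thesis using i by (simp add: \<beta>_def)
  next
    case False
    then show ?thesis by (auto simp: lookup_single when_def \<beta>_def)
  qed
  have "lookup (dD S) \<beta> = (\<Sum>\<gamma>\<in>Poly_Mapping.keys S. lookup S \<gamma> * lookup (dmono_deriv \<gamma>) \<beta>)"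
    unfolding dD_def lookup_sum by (simp add: dconst_def flip: mult_map_scale_conv_mult)
       (auto simp: map.rep_eq when_def intro!: sum.cong)
  also have "\<dots> = (\<Sum>\<gamma>\<in>Poly_Mapping.keys S. if \<gamma> = \<alpha> then lookup S \<alpha> * of_nat (lookup \<alpha> n) else 0)"
  proof (intro sum.cong refl)
    fix \<gamma> assume \<gamma>: "\<gamma> \<in> Poly_Mapping.keys S"
    have "lookup (dmono_deriv \<gamma>) \<beta>
        = (\<Sum>i\<in>Poly_Mapping.keys \<gamma>. if \<gamma> = \<alpha> \<and> i = n then of_nat (lookup \<alpha> n) else 0)"
      unfolding dmono_deriv_def lookup_sum by (intro sum.cong refl summand \<gamma>)
    also have "\<dots> = (if \<gamma> = \<alpha> then of_nat (lookup \<alpha> n) else 0)"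
      using \<alpha>(2) by (auto simp: in_keys_iff)
    finally show "lookup S \<gamma> * lookup (dmono_deriv \<gamma>) \<beta> = (if \<gamma> = \<alpha> then lookup S \<alpha> * of_nat (lookup \<alpha> n) else 0)"
      by simp
  qed
  also have "\<dots> = lookup S \<alpha> * of_nat (lookup \<alpha> n)"
    using \<alpha>(1) by simp
  finally show False
    using \<alpha> assms by (auto simp: in_keys_iff)
qed

unbundle no vec_syntax

subsection \<open>The hierarchy\<close>

text \<open>The value of \<open>sigma r (Suc j)\<close> is read off from the coefficient of index \<open>j + 1\<close> in the first integral.\<close>

function sigma rho :: "real \<Rightarrow> nat \<Rightarrow> dpoly" where
  "sigma r 0 = 1"
| "sigma r (Suc j) = dconst (1 / (8 * r)) *
     ((\<Sum>i\<le>j. rho r i * rho r (j - i)) + dconst r * (\<Sum>i<j. dD (rho r i) * dD (rho r (j - 1 - i)))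
      - dconst (4 * r) * (\<Sum>i\<in>{1..j}. sigma r i * sigma r (Suc j - i)))"
| "rho r 0 = 2 * dvar 0"
| "rho r (Suc j) = 2 * dvar 0 * sigma r (Suc j) - dconst r * dD (dD (rho r j))"
  by pat_completeness auto
termination
  \<comment> \<open>The values are computed in the order \<open>sigma r 0\<close>,
    \<open>rho r 0\<close>, \<open>sigma r 1\<close>, \<open>rho r 1\<close>, and so on.\<close>
  by (relation "Wellfounded.measure (\<lambda>x. case x of Inl (r, j) \<Rightarrow> 2 * j | Inr (r, j) \<Rightarrow> 2 * j + 1)") auto

declare sigma.simps(2) [simp del] rho.simps(2) [simp del]

section \<open>Generating series of the hierarchy and their differential identities\<close>

definition sigma_fps where "sigma_fps r = Abs_fps (sigma r)"
definition rho_fps where "rho_fps r = Abs_fps (rho r)"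

definition dD_fps :: "dpoly fps \<Rightarrow> dpoly fps" where "dD_fps F = Abs_fps (\<lambda>n. dD (F $ n))"

lemma dD_fps_nth [simp]: "dD_fps F $ n = dD (F $ n)"
  by (simp add: dD_fps_def)

lemma dD_fps_add: "dD_fps (F + G) = dD_fps F + dD_fps G"
  by (rule fps_ext) (simp add: dD_add)

lemma dD_fps_minus: "dD_fps (- F) = - dD_fps F"
  by (rule fps_ext) (simp add: dD_minus)

lemma dD_fps_diff: "dD_fps (F - G) = dD_fps F - dD_fps G"
  using dD_fps_add[of F "-G"] by (simp add: dD_fps_minus)

lemma dD_fps_mult: "dD_fps (F * G) = F * dD_fps G + dD_fps F * G"
  by (rule fps_ext) (simp add: fps_mult_nth dD_sum dD_mult sum.distrib)

lemma dD_numeral [simp]: "dD (numeral n) = 0"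
  using dD_dconst[of "numeral n"] by simp

lemma dD_1 [simp]: "dD 1 = 0"
  using dD_dconst[of 1] by simp

lemma dD_fps_const [simp]: "dD_fps (fps_const c) = fps_const (dD c)"
  by (rule fps_ext) simp

lemma dD_fps_X [simp]: "dD_fps fps_X = 0"
  by (rule fps_ext) (simp add: fps_X_def)

lemma dD_fps_numeral [simp]: "dD_fps (numeral n) = 0"
  by (simp add: numeral_fps_const)

abbreviation const_fps :: "real \<Rightarrow> dpoly fps" where "const_fps c \<equiv> fps_const (dconst c)"

lemma const_fps_mult: "const_fps (a * b) = const_fps a * const_fps b"
  by (simp add: dconst_mult)

lemma const_fps_numeral [simp]: "const_fps (numeral n) = numeral n"
  by (simp add: numeral_fps_const)

abbreviation u_fps :: "dpoly fps" where "u_fps \<equiv> fps_const (dvar 0)"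

text \<open>The recursion for \<open>rho\<close> as one identity; index 0 fits because
  \<open>sigma r 0 = 1\<close>.\<close>

lemma rho_fps_rec: "rho_fps r = 2 * u_fps * sigma_fps r - const_fps r * fps_X * dD_fps (dD_fps (rho_fps r))"
proof (rule fps_ext)
  fix n
  show "rho_fps r $ n = (2 * u_fps * sigma_fps r - const_fps r * fps_X * dD_fps (dD_fps (rho_fps r))) $ n"
    by (cases n) (simp_all add: rho_fps_def sigma_fps_def mult.assoc numeral_fps_const rho.simps(2))
qed

text \<open>Holds by construction: as \<open>sigma r 0 = 1\<close>, the coefficient of index
  \<open>j + 1\<close> of the square contains \<open>sigma r (Suc j)\<close> linearly with factor 2,
  and the definition of \<open>sigma\<close> solves for it. The constant \<open>4 * r\<close>
  accounts for index 0.\<close>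

lemma sigma_fps_quadratic:
  assumes "r \<noteq> 0"
  shows "const_fps r * (4 * sigma_fps r ^ 2 - fps_X ^ 2 * dD_fps (rho_fps r) ^ 2) = fps_X * rho_fps r ^ 2 + const_fps (4 * r)"
proof (rule fps_ext)
  fix n
  show "(const_fps r * (4 * sigma_fps r ^ 2 - fps_X ^ 2 * dD_fps (rho_fps r) ^ 2)) $ n = (fps_X * rho_fps r ^ 2 + const_fps (4 * r)) $ n"
  proof (cases n)
    case 0
    then show ?thesis by (simp add: sigma_fps_def power2_eq_square dconst_mult numeral_fps_const)
  next
    case (Suc j)
    have split: "{0..Suc j} = insert 0 (insert (Suc j) {1..j})" by auto
    have "(sigma_fps r ^ 2) $ Suc j = 2 * sigma r (Suc j) + (\<Sum>i\<in>{1..j}. sigma r i * sigma r (Suc j - i))"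
      unfolding power2_eq_square fps_mult_nth split by (simp add: sigma_fps_def)
    moreover have "(fps_X ^ 2 * dD_fps (rho_fps r) ^ 2) $ Suc j = (\<Sum>i<j. dD (rho r i) * dD (rho r (j - 1 - i)))"
    proof (cases j)
      case (Suc k)
      then show ?thesis
        unfolding power2_eq_square[of "dD_fps _"] fps_X_power_mult_nth
        by (simp add: fps_mult_nth rho_fps_def lessThan_Suc_atMost atLeast0AtMost)
    qed (simp add: fps_X_power_mult_nth)
    moreover have "(fps_X * rho_fps r ^ 2) $ Suc j = (\<Sum>i\<le>j. rho r i * rho r (j - i))"
      unfolding power2_eq_square[of "rho_fps r"] fps_X_mult_nth fps_mult_nth[of "rho_fps r"]
      by (simp add: rho_fps_def atLeast0AtMost)
    moreover have "dconst (8 * r) * dconst (1 / (8 * r)) = 1"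
      using assms by (simp flip: dconst_mult)
    then have "dconst (8 * r) * sigma r (Suc j) = ((\<Sum>i\<le>j. rho r i * rho r (j - i))
        + dconst r * (\<Sum>i<j. dD (rho r i) * dD (rho r (j - 1 - i)))
      - dconst (4 * r) * (\<Sum>i\<in>{1..j}. sigma r i * sigma r (Suc j - i)))"
      unfolding sigma.simps(2)[of r j] mult.assoc[symmetric] by (simp only: mult_1)
    moreover have "d * (4 * (2 * s + C) - B) = A"
      if "8 * d * s = A + d * B - 4 * d * C" for d s A B C :: dpoly
      using that by (simp add: algebra_simps)
    ultimately show ?thesis
      unfolding Suc numeral_fps_const fps_mult_left_const_nth fps_sub_nth fps_add_nth dconst_mult
      by (simp add: mult.assoc)
  qed
qed

lemma dD_fps_sgF:
  assumes "r \<noteq> 0"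
  shows "const_fps (2 * r) * dD_fps (sigma_fps r) = u_fps * fps_X * dD_fps (rho_fps r)"
proof -
  let ?s = "sigma_fps r" and ?h = "rho_fps r" and ?X = "fps_X :: dpoly fps"
  have "dD_fps (const_fps r * (4 * ?s ^ 2 - ?X ^ 2 * dD_fps ?h ^ 2)) = dD_fps (?X * ?h ^ 2 + const_fps (4 * r))"
    using sigma_fps_quadratic[OF assms] by simp
  then have "const_fps r * (8 * ?s * dD_fps ?s - 2 * ?X ^ 2 * dD_fps ?h * dD_fps (dD_fps ?h)) = 2 * ?X * ?h * dD_fps ?h"
    by (simp add: dD_fps_mult dD_fps_add dD_fps_diff power2_eq_square algebra_simps)
  also have "\<dots> = 2 * ?X * (2 * u_fps * ?s - const_fps r * ?X * dD_fps (dD_fps ?h)) * dD_fps ?h"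
    using rho_fps_rec[of r] by simp
  finally have "4 * ?s * (2 * const_fps r * dD_fps ?s - u_fps * ?X * dD_fps ?h) = 0"
    by (simp add: algebra_simps power2_eq_square)
  moreover have "?s \<noteq> 0"
    by (metis fps_zero_nth sigma_fps_def fps_nth_Abs_fps sigma.simps(1) zero_neq_one)
  ultimately have "2 * const_fps r * dD_fps ?s = u_fps * ?X * dD_fps ?h"
    by (simp only: mult_eq_0_iff) simp
  then show ?thesis by (simp only: const_fps_mult const_fps_numeral)
qed

text \<open>The companion of the first integral for odd orders, used in \<open>top_cancel\<close>.
  The derivative of sigma is eliminated by \<open>dD_fps_sgF\<close>, the second derivative of rho
  by \<open>rho_fps_rec\<close>.\<close>

lemma sigma_fps_second:
  assumes "r \<noteq> 0"
  shows "u_fps * (4 * sigma_fps r ^ 2 - fps_X ^ 2 * dD_fps (rho_fps r) ^ 2)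
    + 2 * const_fps r * fps_X * (dD_fps (rho_fps r) * dD_fps (sigma_fps r) - sigma_fps r * dD_fps (dD_fps (rho_fps r))) = 2 * rho_fps r * sigma_fps r"
proof -
  have "2 * rho_fps r * sigma_fps r = 2 * (2 * u_fps * sigma_fps r - const_fps r * fps_X * dD_fps (dD_fps (rho_fps r))) * sigma_fps r"
    using rho_fps_rec[of r] by simp
  moreover have "2 * const_fps r * dD_fps (sigma_fps r) = u_fps * fps_X * dD_fps (rho_fps r)"
    using dD_fps_sgF[OF assms] by (simp only: const_fps_mult const_fps_numeral)
  moreover have "u * (4 * s ^ 2 - X ^ 2 * h' ^ 2) + 2 * d * X * (h' * s' - s * h'') = 2 * h * s"
    if "2 * h * s = 2 * (2 * u * s - d * X * h'') * s" "2 * d * s' = u * X * h'"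
    for u s X h' d s' h'' h :: "dpoly fps"
    using that by algebra
  ultimately show ?thesis by blast
qed

lemma dD_sigma_Suc:
  assumes "r \<noteq> 0"
  shows "dconst (2 * r) * dD (sigma r (Suc j)) = dvar 0 * dD (rho r j)"
  using arg_cong[OF dD_fps_sgF[OF assms], of "\<lambda>F. F $ Suc j"]
  by (simp add: sigma_fps_def rho_fps_def mult.assoc)

text \<open>Exponents are natural numbers, so a product of monomials is 1 only if both factors
  are.\<close>

lemma lookup_0_mult: "lookup (P * Q) 0 = lookup P 0 * lookup (Q :: dpoly) 0"
proof -
  have *: "lookup (single \<alpha> c * single \<beta> d) 0 = lookup (single \<alpha> c) 0 * lookup (single \<beta> d :: dpoly) 0" for \<alpha> \<beta> c d
  proof -
    have "\<alpha> + \<beta> = 0 \<longleftrightarrow> \<alpha> = 0 \<and> \<beta> = 0"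
      by (auto simp: poly_mapping_eq_iff fun_eq_iff lookup_add)
    then show ?thesis by (auto simp: mult_single lookup_single when_def)
  qed
  have "lookup ((\<Sum>\<alpha>\<in>A. single \<alpha> (c \<alpha>)) * (\<Sum>\<beta>\<in>B. single \<beta> (d \<beta>))) 0
     = lookup (\<Sum>\<alpha>\<in>A. single \<alpha> (c \<alpha>)) 0 * lookup (\<Sum>\<beta>\<in>B. single \<beta> (d \<beta>) :: dpoly) 0" for A B c d
    by (simp only: sum_product lookup_sum *)
  from this[where A = "Poly_Mapping.keys P" and c = "lookup P" and B = "Poly_Mapping.keys Q" and d = "lookup Q"]
  show ?thesis
    by (simp only: dpoly_single_sum[symmetric])
qed

lemma lookup_0_dvar: "lookup (dvar i) 0 = 0"
proof -
  have "single i (1::nat) \<noteq> 0"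
    by (metis lookup_single_eq lookup_zero zero_neq_one)
  then show ?thesis unfolding dvar_def by (simp only: lookup_single when_def if_False)
qed

lemma lookup_0_dD: "lookup (dD P) 0 = 0"
proof (induction P rule: dpoly_induct)
  case (mult p q)
  then show ?case by (simp add: dD_mult lookup_add lookup_0_mult)
qed (simp_all add: dD_add lookup_add lookup_0_dvar)

lemma lookup_0_rho: "lookup (rho r j) 0 = 0"
  by (cases j) (simp_all add: lookup_0_mult lookup_0_dD lookup_0_dvar lookup_minus rho.simps(2))

lemma lookup_0_sigma: "lookup (sigma r (Suc j)) 0 = 0"
proof (induction j rule: less_induct)
  case (less j)
  \<comment> \<open>Since the range omits \<open>i = 0\<close>, the first factor is an earlier
    \<open>sigma\<close> of positive index and has no constant term by induction.\<close>
  have "lookup (sigma r i * sigma r (Suc j - i)) 0 = 0" if "i \<in> {1..j}" for i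
  proof -
    from that obtain k where "i = Suc k" "k < j" by (cases i) auto
    then show ?thesis using less[of k] by (simp add: lookup_0_mult)
  qed
  then have "(\<Sum>i\<in>{1..j}. lookup (sigma r i * sigma r (Suc j - i)) 0) = 0"
    by (intro sum.neutral) auto
  then show ?case
    by (simp add: sigma.simps(2) lookup_0_mult lookup_add lookup_minus lookup_sum lookup_0_rho lookup_0_dD)
qed

text \<open>The factor \<open>- 1 / (4 * r)\<close> turns \<open>rho r 0 = 2 * dvar 0\<close> into
  R_0. The definite description in \<open>RS\<close> is resolved here: \<open>dD_sigma_Suc\<close>
  supplies a solution without constant term, and two solutions differ by an element of zero
  derivative, hence by a constant, which is 0.\<close>

lemma RS_eq:
  assumes "r > 0"
  shows "RS r j = (dconst (- 1 / (4 * r)) * rho r j, dconst (- 1 / (4 * r)) * sigma r (Suc j))"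
proof (induction j)
  case 0
  have "dconst (1 / (8 * r)) * (4 * dvar 0 ^ 2) = dconst (1 / (2 * r)) * dvar 0 ^ 2"
    by (simp flip: mult.assoc dconst_numeral dconst_mult)
  then have "sigma r (Suc 0) = dconst (1 / (2 * r)) * dvar 0 ^ 2"
    by (simp add: sigma.simps(2) power2_eq_square mult_ac)
  moreover have "- 1 / (4 * r) * (1 / (2 * r)) = - 1 / (8 * r ^ 2)"
    by (simp add: power2_eq_square)
  ultimately have "dconst (- 1 / (4 * r)) * sigma r (Suc 0) = dconst (- 1 / (8 * r ^ 2)) * dvar 0 ^ 2"
    by (metis dconst_mult mult.assoc)
  moreover have "dconst (- 1 / (4 * r)) * rho r 0 = dconst (- 1 / (2 * r)) * dvar 0"
    by (simp flip: mult.assoc dconst_numeral dconst_mult)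
  ultimately show ?case unfolding RS.simps by (simp only:)
next
  case (Suc j)
  let ?c = "dconst (- 1 / (4 * r))"
  define Rn where "Rn = - (dconst r * dD (dD (fst (RS r j)))) + 2 * dvar 0 * snd (RS r j)"
  have Rn: "Rn = ?c * rho r (Suc j)"
    unfolding Rn_def Suc by (simp add: dD_mult algebra_simps rho.simps(2))
  have "(THE S. dconst (2 * r) * dD S = dvar 0 * dD Rn \<and> lookup S 0 = 0) = ?c * sigma r (Suc (Suc j))"
  proof (rule the_equality)
    have "dconst (2 * r) * dD (?c * sigma r (Suc (Suc j))) = ?c * (dconst (2 * r) * dD (sigma r (Suc (Suc j))))"
      by (simp add: dD_mult mult_ac)
    also have "\<dots> = dvar 0 * dD Rn"
      using dD_sigma_Suc[of r "Suc j"] assms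
      by (simp add: Rn dD_mult mult_ac)
    finally have e: "dconst (2 * r) * dD (?c * sigma r (Suc (Suc j))) = dvar 0 * dD Rn" .
    then show "dconst (2 * r) * dD (?c * sigma r (Suc (Suc j))) = dvar 0 * dD Rn
        \<and> lookup (?c * sigma r (Suc (Suc j))) 0 = 0"
      by (simp add: lookup_0_mult lookup_0_sigma)
    fix S assume S: "dconst (2 * r) * dD S = dvar 0 * dD Rn \<and> lookup S 0 = 0"
    let ?d = "S - ?c * sigma r (Suc (Suc j))"
    have "dconst (2 * r) * dD ?d = 0"
      using S e dD_add[of S "- (?c * sigma r (Suc (Suc j)))"]
      by (simp add: dD_minus right_diff_distrib)
    moreover have "dconst (2 * r) \<noteq> 0"
      using assms by (metis dconst_def lookup_single_eq lookup_zero mult_eq_0_iff less_irrefl zero_neq_numeral)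
    ultimately have "dD ?d = 0" by simp
    then have "?d = dconst (lookup ?d 0)" by (rule dD_eq_0_imp_const)
    then show "S = ?c * sigma r (Suc (Suc j))"
      using S by (simp add: lookup_minus lookup_0_mult lookup_0_sigma)
  qed
  moreover have "RS r (Suc j) = (Rn, THE S. dconst (2 * r) * dD S = dvar 0 * dD Rn \<and> lookup S 0 = 0)"
    by (simp only: RS.simps Let_def Rn_def)
  ultimately show ?case
    by (simp only: Rn)
qed

lemma Rpoly_eq: "r > 0 \<Longrightarrow> Rpoly r j = dconst (- 1 / (4 * r)) * rho r j"
  by (simp add: Rpoly_def RS_eq)

subsection \<open>Iterated derivatives\<close>

lemma dnx_0 [simp]: "dnx 0 f = f"
  by (simp add: dnx_def)

lemma dnx_Suc: "dnx (Suc n) f x = vector_derivative (dnx n f) (at x)"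
  by (simp add: dnx_def)

lemma dnx_Suc2: "dnx (Suc n) f = dnx n (dnx 1 f)"
  unfolding dnx_def funpow_Suc_right by simp

lemma dnx_add: "dnx (k + n) f = dnx k (dnx n f)"
  by (simp add: dnx_def funpow_add)

section \<open>Locality and linearity of iterated derivatives\<close>

lemma vector_derivative_cong_open:
  assumes "open I" "x \<in> I" "\<And>y. y \<in> I \<Longrightarrow> f y = g y"
  shows "vector_derivative f (at x) = vector_derivative g (at x)"
  by (rule vector_derivative_cong_eq)
     (use assms in \<open>auto intro!: eventually_mono[OF eventually_nhds_in_open[of I]]\<close>)

lemma differentiable_cong_open:
  assumes "open I" "x \<in> I" "\<And>y. y \<in> I \<Longrightarrow> f y = g y" "f differentiable at x"
  shows "g differentiable at x"
proof -
  obtain f' where "(f has_derivative f') (at x)"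
    using assms(4) by (auto simp: differentiable_def)
  then have "(g has_derivative f') (at x)"
    by (rule has_derivative_transform_within_open[OF _ assms(1,2)]) (rule assms(3))
  then show ?thesis by (auto simp: differentiable_def)
qed

lemma dnx_cong:
  assumes "open I" "\<And>y. y \<in> I \<Longrightarrow> f y = g y"
  shows "x \<in> I \<Longrightarrow> dnx n f x = dnx n g x"
proof (induction n arbitrary: x)
  case (Suc n)
  then show ?case
    unfolding dnx_Suc by (intro vector_derivative_cong_open[OF assms(1)]) auto
qed (use assms in auto)

lemma Cinf_on_cong:
  assumes "open I" "\<And>y. y \<in> I \<Longrightarrow> f y = g y" "Cinf_on I f"
  shows "Cinf_on I g"
  unfolding Cinf_on_def
proof (intro allI ballI)
  fix n x assume "x \<in> I"
  have "dnx n f y = dnx n g y" if "y \<in> I" for y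
    using assms(2) that by (rule dnx_cong[OF assms(1)])
  moreover have "dnx n f differentiable at x"
    using assms(3) \<open>x \<in> I\<close> by (simp add: Cinf_on_def)
  ultimately show "dnx n g differentiable at x"
    by (rule differentiable_cong_open[OF assms(1) \<open>x \<in> I\<close>])
qed

lemma Cinf_on_dnx: "Cinf_on I f \<Longrightarrow> Cinf_on I (dnx n f)"
  by (simp add: Cinf_on_def flip: dnx_add)

lemma Cinf_on_has_derivative:
  "Cinf_on I f \<Longrightarrow> x \<in> I \<Longrightarrow> (dnx n f has_vector_derivative dnx (Suc n) f x) (at x)"
  by (simp add: Cinf_on_def dnx_Suc vector_derivative_works)

text \<open>Bounded linear maps cover both the embedding \<open>of_real\<close> and multiplication
  by a fixed complex number.\<close>

lemma dnx_linear:
  fixes T :: "'a::real_normed_vector \<Rightarrow> 'b::real_normed_vector"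
  assumes "open I" "bounded_linear T" "Cinf_on I f"
  shows "x \<in> I \<Longrightarrow> dnx n (\<lambda>x. T (f x)) x = T (dnx n f x)"
proof (induction n arbitrary: x)
  case (Suc n)
  have "((\<lambda>x. T (dnx n f x)) has_vector_derivative T (dnx (Suc n) f x)) (at x)"
    using Cinf_on_has_derivative[OF assms(3) Suc.prems] bounded_linear.has_vector_derivative[OF assms(2)] by blast
  moreover have "vector_derivative (dnx n (\<lambda>x. T (f x))) (at x) = vector_derivative (\<lambda>x. T (dnx n f x)) (at x)"
    by (rule vector_derivative_cong_open[OF assms(1) Suc.prems]) (use Suc.IH in auto)
  ultimately show ?case
    unfolding dnx_Suc[of n "\<lambda>x. T (f x)"] by (simp add: vector_derivative_at)
qed simp

lemma Cinf_on_linear: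
  assumes "open I" "bounded_linear T" "Cinf_on I f"
  shows "Cinf_on I (\<lambda>x. T (f x))"
  unfolding Cinf_on_def
proof (intro allI ballI)
  fix n x assume x: "x \<in> I"
  have "(\<lambda>x. T (dnx n f x)) differentiable at x"
    using Cinf_on_has_derivative[OF assms(3) x] bounded_linear.has_vector_derivative[OF assms(2)]
    by (meson differentiableI_vector)
  then show "dnx n (\<lambda>x. T (f x)) differentiable at x"
    by (rule differentiable_cong_open[OF assms(1) x, rotated]) (simp add: dnx_linear[OF assms])
qed

lemma dnx_plus:
  assumes "open I" "Cinf_on I f" "Cinf_on I g"
  shows "x \<in> I \<Longrightarrow> dnx n (\<lambda>x. f x + g x) x = dnx n f x + dnx n g x"
proof (induction n arbitrary: x)
  case (Suc n)
  have "((\<lambda>x. dnx n f x + dnx n g x) has_vector_derivative dnx (Suc n) f x + dnx (Suc n) g x) (at x)"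
    using Cinf_on_has_derivative[OF _ Suc.prems] assms by (intro has_vector_derivative_add) auto
  moreover have "vector_derivative (dnx n (\<lambda>x. f x + g x)) (at x) = vector_derivative (\<lambda>x. dnx n f x + dnx n g x) (at x)"
    by (rule vector_derivative_cong_open[OF assms(1) Suc.prems]) (use Suc.IH in auto)
  ultimately show ?case
    unfolding dnx_Suc[of n "\<lambda>x. f x + g x"] by (simp add: vector_derivative_at)
qed simp

lemma Cinf_on_plus:
  assumes "open I" "Cinf_on I f" "Cinf_on I g"
  shows "Cinf_on I (\<lambda>x. f x + g x)"
  unfolding Cinf_on_def
proof (intro allI ballI)
  fix n x assume x: "x \<in> I"
  have "(\<lambda>x. dnx n f x + dnx n g x) differentiable at x"
    using assms x by (auto simp: Cinf_on_def)
  then show "dnx n (\<lambda>x. f x + g x) differentiable at x"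
    by (rule differentiable_cong_open[OF assms(1) x, rotated]) (simp add: dnx_plus[OF assms])
qed

lemma dnx_const: "dnx n (\<lambda>x. c) = (\<lambda>x. if n = 0 then c else 0)"
proof (induction n)
  case (Suc n)
  show ?case by (rule ext) (simp add: dnx_Suc Suc)
qed auto

lemma Cinf_on_const: "Cinf_on I (\<lambda>x. c)"
  by (simp add: Cinf_on_def dnx_const)

lemma Cinf_on_sum:
  assumes "open I" "\<And>i. i \<in> A \<Longrightarrow> Cinf_on I (f i)"
  shows "Cinf_on I (\<lambda>x. \<Sum>i\<in>A. f i x)"
  using assms(2) by (induction A rule: infinite_finite_induct) (auto simp: Cinf_on_const Cinf_on_plus[OF assms(1)])

lemma dnx_sum:
  assumes "open I" "\<And>i. i \<in> A \<Longrightarrow> Cinf_on I (f i)" "x \<in> I"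
  shows "dnx n (\<lambda>x. \<Sum>i\<in>A. f i x) x = (\<Sum>i\<in>A. dnx n (f i) x)"
  using assms(2)
  by (induction A rule: infinite_finite_induct)
     (auto simp: dnx_const dnx_plus[OF assms(1)] Cinf_on_sum[OF assms(1)] assms(3))

lemma dnx_1_mult:
  fixes f g :: "real \<Rightarrow> 'a::real_normed_algebra"
  assumes "Cinf_on I f" "Cinf_on I g" "x \<in> I"
  shows "dnx 1 (\<lambda>x. f x * g x) x = f x * dnx 1 g x + dnx 1 f x * g x"
  using has_vector_derivative_mult[OF Cinf_on_has_derivative[OF assms(1,3), of 0] Cinf_on_has_derivative[OF assms(2,3), of 0]]
  by (simp add: dnx_Suc vector_derivative_at)

lemma Cinf_on_mult:
  fixes f g :: "real \<Rightarrow> 'a::real_normed_algebra"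
  assumes "open I" "Cinf_on I f" "Cinf_on I g"
  shows "Cinf_on I (\<lambda>x. f x * g x)"
proof -
  \<comment> \<open>The closure of \<open>f g\<close> under differentiation consists of sums of such products, so the
    induction is over all finite sums at once.\<close>
  have "\<forall>x\<in>I. dnx n (\<lambda>x. \<Sum>i<k. f i x * g i x) differentiable at x"
    if "\<forall>i<k. Cinf_on I (f i) \<and> Cinf_on I (g i)" for n k :: nat and f g :: "nat \<Rightarrow> real \<Rightarrow> 'a"
    using that
  proof (induction n arbitrary: k f g)
    case 0
    have "f i differentiable at x" "g i differentiable at x" if "i < k" "x \<in> I" for i x
      using 0 that unfolding Cinf_on_def by (metis dnx_0)+
    then show ?case by (auto intro!: differentiable_sum differentiable_mult)
  next
    case (Suc n)
    \<comment> \<open>The derivative of a sum of k products as a sum of 2k products: indices below k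
      carry f g', the next k carry f' g.\<close>
    define f' where "f' i = (if i < k then f i else dnx 1 (f (i - k)))" for i
    define g' where "g' i = (if i < k then dnx 1 (g i) else g (i - k))" for i
    have C: "\<forall>i<2*k. Cinf_on I (f' i) \<and> Cinf_on I (g' i)"
      using Suc.prems Cinf_on_dnx[where n = 1] unfolding f'_def g'_def by auto
    have "dnx 1 (\<lambda>x. \<Sum>i<k. f i x * g i x) x = (\<Sum>i<2*k. f' i x * g' i x)" if x: "x \<in> I" for x
    proof -
      have "((\<lambda>x. \<Sum>i<k. f i x * g i x) has_vector_derivative
          (\<Sum>i<k. f i x * dnx 1 (g i) x + dnx 1 (f i) x * g i x)) (at x)"
      proof (intro has_vector_derivative_sum)
        fix i assume "i \<in> {..<k}"
        then show "((\<lambda>x. f i x * g i x) has_vector_derivative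
            f i x * dnx 1 (g i) x + dnx 1 (f i) x * g i x) (at x)"
          using has_vector_derivative_mult[OF Cinf_on_has_derivative[of I "f i" x 0] Cinf_on_has_derivative[of I "g i" x 0]] Suc.prems x
          by (simp add: has_vector_derivative_mult)
      qed
      moreover have "(\<Sum>i<k+m. f' i x * g' i x)
          = (\<Sum>i<k. f i x * dnx 1 (g i) x) + (\<Sum>i<m. dnx 1 (f i) x * g i x)" for m
        by (induction m) (auto simp: f'_def g'_def add.assoc)
      from this[of k] have "(\<Sum>i<2*k. f' i x * g' i x) = (\<Sum>i<k. f i x * dnx 1 (g i) x + dnx 1 (f i) x * g i x)"
        by (simp add: mult_2 sum.distrib)
      ultimately show ?thesis
        by (simp add: dnx_Suc vector_derivative_at)
    qed
    then have "dnx n (\<lambda>x. \<Sum>i<2*k. f' i x * g' i x) x = dnx (Suc n) (\<lambda>x. \<Sum>i<k. f i x * g i x) x" if "x \<in> I" for x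
      unfolding dnx_Suc2 using that by (intro dnx_cong[OF assms(1)]) auto
    with Suc.IH[OF C] show ?case
      using differentiable_cong_open[OF assms(1)] by blast
  qed
  from this[where k = 1 and f = "\<lambda>_. f" and g = "\<lambda>_. g"] assms show ?thesis
    by (simp add: Cinf_on_def)
qed

subsection \<open>Evaluation of differential polynomials\<close>

definition mono_eval :: "(nat \<Rightarrow>\<^sub>0 nat) \<Rightarrow> (real \<Rightarrow> real) \<Rightarrow> real \<Rightarrow> real" where
  "mono_eval \<alpha> u x = (\<Prod>i\<in>Poly_Mapping.keys \<alpha>. dnx i u x ^ lookup \<alpha> i)"

lemma deval_superset:
  assumes "finite K" "Poly_Mapping.keys P \<subseteq> K"
  shows "deval P u x = (\<Sum>\<alpha>\<in>K. lookup P \<alpha> * mono_eval \<alpha> u x)"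
  unfolding deval_def mono_eval_def
  by (rule sum.mono_neutral_left) (use assms in \<open>auto simp: in_keys_iff\<close>)

lemma mono_eval_superset:
  assumes "finite K" "Poly_Mapping.keys \<alpha> \<subseteq> K"
  shows "mono_eval \<alpha> u x = (\<Prod>i\<in>K. dnx i u x ^ lookup \<alpha> i)"
  unfolding mono_eval_def
  by (rule prod.mono_neutral_left) (use assms in \<open>auto simp: in_keys_iff\<close>)

lemma mono_eval_add: "mono_eval (\<alpha> + \<beta>) u x = mono_eval \<alpha> u x * mono_eval \<beta> u x"
proof -
  let ?K = "Poly_Mapping.keys \<alpha> \<union> Poly_Mapping.keys \<beta>"
  have K: "finite ?K" "Poly_Mapping.keys \<alpha> \<subseteq> ?K" "Poly_Mapping.keys \<beta> \<subseteq> ?K"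
    "Poly_Mapping.keys (\<alpha> + \<beta>) \<subseteq> ?K"
    using keys_add[of \<alpha> \<beta>] by auto
  show ?thesis
    unfolding mono_eval_superset[OF K(1,2)] mono_eval_superset[OF K(1,3)] mono_eval_superset[OF K(1,4)]
    by (simp add: lookup_add power_add prod.distrib)
qed

lemma deval_add: "deval (P + Q) u x = deval P u x + deval Q u x"
proof -
  let ?K = "Poly_Mapping.keys P \<union> Poly_Mapping.keys Q"
  have K: "finite ?K" "Poly_Mapping.keys P \<subseteq> ?K" "Poly_Mapping.keys Q \<subseteq> ?K"
    "Poly_Mapping.keys (P + Q) \<subseteq> ?K"
    using keys_add[of P Q] by auto
  show ?thesis
    unfolding deval_superset[OF K(1,2)] deval_superset[OF K(1,3)] deval_superset[OF K(1,4)]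
    by (simp add: lookup_add algebra_simps sum.distrib)
qed

lemma deval_0 [simp]: "deval 0 u x = 0"
  by (simp add: deval_def)

lemma deval_sum: "deval (sum f A) u x = (\<Sum>i\<in>A. deval (f i) u x)"
  by (induction A rule: infinite_finite_induct) (auto simp: deval_add)

lemma deval_single: "deval (single \<alpha> c) u x = c * mono_eval \<alpha> u x"
  by (subst deval_superset[of "{\<alpha>}"]) auto

lemma deval_mult: "deval (P * Q) u x = deval P u x * deval Q u x"
proof -
  have "deval ((\<Sum>\<alpha>\<in>A. single \<alpha> (c \<alpha>)) * (\<Sum>\<beta>\<in>B. single \<beta> (d \<beta>))) u x
     = deval (\<Sum>\<alpha>\<in>A. single \<alpha> (c \<alpha>)) u x * deval (\<Sum>\<beta>\<in>B. single \<beta> (d \<beta>)) u x" for A B c d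
    by (simp only: sum_product deval_sum mult_single deval_single mono_eval_add mult_ac)
  from this[where A = "Poly_Mapping.keys P" and c = "lookup P" and B = "Poly_Mapping.keys Q" and d = "lookup Q"]
  show ?thesis
    by (simp only: dpoly_single_sum[symmetric])
qed

lemma deval_dconst [simp]: "deval (dconst c) u x = c"
  by (simp add: dconst_def deval_single mono_eval_def)

lemma deval_dvar [simp]: "deval (dvar i) u x = dnx i u x"
  by (simp add: dvar_def deval_single mono_eval_def)

lemma deval_1 [simp]: "deval 1 u x = 1"
  using deval_dconst[of 1] by simp

lemma Cinf_on_deval:
  assumes "open I" "Cinf_on I u"
  shows "Cinf_on I (deval P u)"
proof (induction P rule: dpoly_induct)
  case (const c)
  have "deval (dconst c) u = (\<lambda>x. c)" by auto
  then show ?case by (simp add: Cinf_on_const)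
next
  case (var i)
  have "deval (dvar i) u = dnx i u" by auto
  then show ?case using Cinf_on_dnx[OF assms(2)] by simp
next
  case (add p q)
  have "deval (p + q) u = (\<lambda>x. deval p u x + deval q u x)" by (auto simp: deval_add)
  then show ?case using Cinf_on_plus[OF assms(1) add] by simp
next
  case (mult p q)
  have "deval (p * q) u = (\<lambda>x. deval p u x * deval q u x)" by (auto simp: deval_mult)
  then show ?case using Cinf_on_mult[OF assms(1) mult] by simp
qed

text \<open>Both sides obey the sum and product rules, so constants and jet variables suffice;
  \<open>dvar i\<close> evaluates to \<open>dnx i u\<close>, whose derivative is the next
  jet.\<close>

lemma deval_dD:
  assumes I: "open I" "Cinf_on I u"
  shows "x \<in> I \<Longrightarrow> deval (dD P) u x = dnx 1 (deval P u) x"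
proof (induction P rule: dpoly_induct)
  case (const c)
  have "deval (dconst c) u = (\<lambda>x. c)" by auto
  then show ?case by (simp add: dnx_const)
next
  case (var i)
  have "deval (dvar i) u = dnx i u" by auto
  then show ?case by (simp add: dnx_Suc)
next
  case (add p q)
  have "deval (p + q) u = (\<lambda>x. deval p u x + deval q u x)" by (auto simp: deval_add)
  then show ?case
    using add dnx_plus[OF I(1) Cinf_on_deval[OF I] Cinf_on_deval[OF I], of x 1 p q] by (simp add: dD_add deval_add)
next
  case (mult p q)
  have "deval (p * q) u = (\<lambda>x. deval p u x * deval q u x)" by (auto simp: deval_mult)
  then show ?case
    using mult dnx_1_mult[OF Cinf_on_deval[OF I] Cinf_on_deval[OF I], of x p q]
    by (simp add: dD_mult deval_add deval_mult)
qed

lemma deval_dD_pow: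
  assumes I: "open I" "Cinf_on I u" "x \<in> I"
  shows "deval ((dD ^^ n) P) u x = dnx n (deval P u) x"
proof (induction n arbitrary: P)
  case (Suc n)
  have "deval ((dD ^^ Suc n) P) u x = dnx n (deval (dD P) u) x"
    using Suc[of "dD P"] by (simp add: funpow_swap1)
  also have "\<dots> = dnx (Suc n) (deval P u) x"
    unfolding dnx_Suc2 by (intro dnx_cong[OF I(1) _ I(3)] deval_dD[OF I(1,2)])
  finally show ?case .
qed simp

subsection \<open>Families of polynomials in \<open>1/z\<close>\<close>

text \<open>Stated with degree bounds instead of degrees, because the tracked top coefficients may
  vanish at particular points.\<close>

lemma coeff_mult_top:
  fixes p q :: "'a::comm_semiring_0 poly"
  assumes "degree p \<le> a" "degree q \<le> b"
  shows "coeff (p * q) (a + b) = coeff p a * coeff q b"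
proof -
  have "coeff (p * q) (a + b) = (\<Sum>i\<le>a + b. coeff p i * coeff q (a + b - i))"
    by (simp add: coeff_mult)
  also have "\<dots> = (\<Sum>i\<le>a + b. if i = a then coeff p a * coeff q b else 0)"
  proof (intro sum.cong refl)
    fix i assume "i \<in> {..a + b}"
    then consider "i < a" | "i = a" | "i > a" by force
    then show "coeff p i * coeff q (a + b - i) = (if i = a then coeff p a * coeff q b else 0)"
    proof cases
      case 1
      then have "coeff q (a + b - i) = 0" using assms by (intro coeff_eq_0) auto
      then show ?thesis using 1 by simp
    next
      case 3
      then have "coeff p i = 0" using assms by (intro coeff_eq_0) auto
      then show ?thesis using 3 by simp
    qed simp
  qed
  finally show ?thesis by simp
qed

locale double_scaling =
  fixes rc :: real and I :: "real set" and u :: "real \<Rightarrow> real"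
  assumes rc: "rc > 0" and oI: "open I" and smooth_u: "Cinf_on I u"
begin

text \<open>\<open>F\<close> is a polynomial in \<open>1/z\<close> of degree at most \<open>d\<close> with smooth coefficients, the coefficient of
  index \<open>d\<close> is the differential polynomial \<open>P\<close> in \<open>u\<close>, and \<open>F\<close> vanishes at infinity if \<open>v\<close> holds.\<close>
definition rep_by :: "(real \<Rightarrow> complex poly) \<Rightarrow> bool \<Rightarrow> (complex \<Rightarrow> real \<Rightarrow> complex) \<Rightarrow> nat \<Rightarrow> dpoly \<Rightarrow> bool" where
  "rep_by p v F d P \<longleftrightarrow> (\<forall>i. Cinf_on I (\<lambda>x. coeff (p x) i)) \<and>
     (\<forall>x\<in>I. degree (p x) \<le> d \<and> coeff (p x) d = of_real (deval P u x) \<and> (v \<longrightarrow> coeff (p x) 0 = 0)) \<and>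
     (\<forall>z. \<forall>x\<in>I. 4 * rc < norm z \<longrightarrow> F z x = poly (p x) (1 / z))"

definition rep :: "bool \<Rightarrow> (complex \<Rightarrow> real \<Rightarrow> complex) \<Rightarrow> nat \<Rightarrow> dpoly \<Rightarrow> bool" where
  "rep v F d P \<longleftrightarrow> (\<exists>p. rep_by p v F d P)"

lemma repI:
  assumes "\<And>i. Cinf_on I (\<lambda>x. coeff (p x) i)" "\<And>x. x \<in> I \<Longrightarrow> degree (p x) \<le> d"
    "\<And>x. x \<in> I \<Longrightarrow> coeff (p x) d = of_real (deval P u x)"
    "\<And>x. x \<in> I \<Longrightarrow> v \<Longrightarrow> coeff (p x) 0 = 0"
    "\<And>z x. x \<in> I \<Longrightarrow> 4 * rc < norm z \<Longrightarrow> F z x = poly (p x) (1 / z)"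
  shows "rep v F d P"
  unfolding rep_def rep_by_def by (rule exI[of _ p]) (use assms in blast)

lemma rep_byD:
  assumes "rep_by p v F d P"
  shows "Cinf_on I (\<lambda>x. coeff (p x) i)" "x \<in> I \<Longrightarrow> degree (p x) \<le> d"
    "x \<in> I \<Longrightarrow> coeff (p x) d = of_real (deval P u x)"
    "x \<in> I \<Longrightarrow> v \<Longrightarrow> coeff (p x) 0 = 0"
    "x \<in> I \<Longrightarrow> 4 * rc < norm z \<Longrightarrow> F z x = poly (p x) (1 / z)"
  using assms unfolding rep_by_def by blast+

lemma rep_cong:
  assumes "rep v F d P" "\<And>z x. 4 * rc < norm z \<Longrightarrow> x \<in> I \<Longrightarrow> G z x = F z x"
  shows "rep v G d P"
proof -
  obtain p where p: "rep_by p v F d P"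
    using assms(1) unfolding rep_def by blast
  note p = rep_byD[OF p]
  show ?thesis by (rule repI[of p]) (use p assms(2) in auto)
qed

text \<open>Contributions of too low degree drop out: relative to a larger bound the tracked
  coefficient is 0, whatever \<open>P\<close> was.\<close>

lemma rep_weaken:
  assumes "rep v F d P" "d < d'"
  shows "rep v F d' 0"
proof -
  obtain p where p: "rep_by p v F d P"
    using assms(1) unfolding rep_def by blast
  note p = rep_byD[OF p]
  have "coeff (p x) d' = 0" if "x \<in> I" for x
    using p(2)[OF that] assms(2) by (intro coeff_eq_0) auto
  then show ?thesis by (intro repI[of p]) (use p assms(2) in \<open>auto intro: order_trans[OF _ less_imp_le]\<close>)
qed

lemma rep_weaken_le: "rep v F d 0 \<Longrightarrow> d \<le> d' \<Longrightarrow> rep v F d' 0"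
  using rep_weaken by (cases "d = d'") auto

lemma rep_weaken_v: "rep v F d P \<Longrightarrow> rep False F d P"
  unfolding rep_def rep_by_def by blast

lemma rep_zero: "rep v (\<lambda>z x. 0) d 0"
  by (rule repI[of "\<lambda>_. 0"]) (auto simp: Cinf_on_const)

lemma rep_add:
  assumes "rep v F d P" "rep v G d Q"
  shows "rep v (\<lambda>z x. F z x + G z x) d (P + Q)"
proof -
  obtain p where p: "rep_by p v F d P"
    using assms(1) unfolding rep_def by blast
  note p = rep_byD[OF p]
  obtain q where q: "rep_by q v G d Q"
    using assms(2) unfolding rep_def by blast
  note q = rep_byD[OF q]
  show ?thesis
    by (rule repI[of "\<lambda>x. p x + q x"])
       (use p q in \<open>auto intro!: Cinf_on_plus oI degree_add_le simp: deval_add\<close>)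
qed

lemma rep_scale:
  assumes "rep v F d P"
  shows "rep v (\<lambda>z x. of_real c * F z x) d (dconst c * P)"
proof -
  obtain p where p: "rep_by p v F d P"
    using assms(1) unfolding rep_def by blast
  note p = rep_byD[OF p]
  show ?thesis
    by (rule repI[of "\<lambda>x. smult (of_real c) (p x)"])
       (use p in \<open>auto intro!: Cinf_on_mult Cinf_on_const oI intro: order_trans[OF degree_smult_le] simp: deval_mult\<close>)
qed

lemma rep_mult:
  assumes "rep v F a P" "rep w G b Q"
  shows "rep (v \<or> w) (\<lambda>z x. F z x * G z x) (a + b) (P * Q)"
proof -
  obtain p where p: "rep_by p v F a P"
    using assms(1) unfolding rep_def by blast
  note p = rep_byD[OF p]
  obtain q where q: "rep_by q w G b Q"
    using assms(2) unfolding rep_def by blast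
  note q = rep_byD[OF q]
  show ?thesis
  proof (rule repI[of "\<lambda>x. p x * q x"])
    show "Cinf_on I (\<lambda>x. coeff (p x * q x) i)" for i
      unfolding coeff_mult by (intro Cinf_on_sum Cinf_on_mult oI p q)
    fix x assume x: "x \<in> I"
    show "degree (p x * q x) \<le> a + b"
      using degree_mult_le[of "p x" "q x"] p(2)[OF x] q(2)[OF x] by linarith
    show "coeff (p x * q x) (a + b) = of_real (deval (P * Q) u x)"
      using coeff_mult_top[OF p(2)[OF x] q(2)[OF x]] p(3)[OF x] q(3)[OF x] by (simp add: deval_mult)
    show "v \<or> w \<Longrightarrow> coeff (p x * q x) 0 = 0"
      using p(4)[OF x] q(4)[OF x] by (auto simp: coeff_mult)
    show "4 * rc < norm z \<Longrightarrow> F z x * G z x = poly (p x * q x) (1 / z)" for z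
      using p(5)[OF x] q(5)[OF x] by simp
  qed
qed

lemma rep_sum:
  assumes "\<And>i. i \<in> A \<Longrightarrow> rep v (F i) d (P i)"
  shows "rep v (\<lambda>z x. \<Sum>i\<in>A. F i z x) d (\<Sum>i\<in>A. P i)"
  using assms by (induction A rule: infinite_finite_induct) (auto simp: rep_zero rep_add)

lemma rep_inverse_mult:
  assumes "rep v F d P"
  shows "rep True (\<lambda>z x. 1 / z * F z x) (Suc d) P"
proof -
  obtain p where p: "rep_by p v F d P"
    using assms(1) unfolding rep_def by blast
  note p = rep_byD[OF p]
  show ?thesis
  proof (rule repI[of "\<lambda>x. pCons 0 (p x)"])
    show "Cinf_on I (\<lambda>x. coeff (pCons 0 (p x)) i)" for i
      using p(1) by (cases i) (auto simp: Cinf_on_const)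
  qed (use p in \<open>auto intro: order_trans[OF degree_pCons_le]\<close>)
qed

text \<open>An arbitrary smooth function is given degree 1 with tracked coefficient 0; one known as
  a differential polynomial keeps degree 0. The first form serves \<open>a i\<close> with
  \<open>i \<ge> 2\<close>, the second \<open>a 0\<close> and \<open>a 1\<close>.\<close>

lemma rep_smooth:
  assumes "Cinf_on I f"
  shows "rep False (\<lambda>z x. of_real (f x)) 1 0"
    and "(\<And>x. x \<in> I \<Longrightarrow> f x = deval P u x) \<Longrightarrow> rep False (\<lambda>z x. of_real (f x)) 0 P"
proof -
  have "Cinf_on I (\<lambda>x. coeff [:complex_of_real (f x):] i)" for i
    using Cinf_on_linear[OF oI bounded_linear_of_real assms]
    by (cases i) (auto simp: Cinf_on_const)
  note * = this
  show "rep False (\<lambda>z x. of_real (f x)) 1 0"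
    by (rule repI[of "\<lambda>x. [:of_real (f x):]"], rule *) auto
  show "rep False (\<lambda>z x. of_real (f x)) 0 P" if "\<And>x. x \<in> I \<Longrightarrow> f x = deval P u x"
    by (rule repI[of "\<lambda>x. [:of_real (f x):]"], rule *) (use that in auto)
qed

text \<open>Trial value for an unknown order, with prescribed top coefficient.\<close>

lemma rep_monomial: "rep (d > 0) (\<lambda>z x. of_real (deval P u x) * (1 / z) ^ d) d P"
proof (rule repI[of "\<lambda>x. monom (of_real (deval P u x)) d"])
  show "Cinf_on I (\<lambda>x. coeff (monom (complex_of_real (deval P u x)) d) i)" for i
    using Cinf_on_linear[OF oI bounded_linear_of_real Cinf_on_deval[OF oI smooth_u, of P]]
    by (cases "d = i") (simp_all add: Cinf_on_const)
qed (auto simp: degree_monom_le poly_monom)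

lemma poly_eq_sum_le: "degree p \<le> d \<Longrightarrow> poly p z = (\<Sum>i\<le>d. coeff p i * (z :: 'a::comm_semiring_1) ^ i)"
  using poly_as_sum_of_monoms'[of p d]
  by (metis (no_types, lifting) poly_monom poly_sum sum.cong)

lemma rep_dnx:
  assumes "rep v F d P"
  shows "rep v (\<lambda>z. dnx n (F z)) d ((dD ^^ n) P)"
proof -
  obtain p where p: "rep_by p v F d P"
    using assms(1) unfolding rep_def by blast
  note p = rep_byD[OF p]
  \<comment> \<open>Coefficientwise derivative, cut off at \<open>d\<close> because the degree of
    \<open>p x\<close> may vary with \<open>x\<close>.\<close>
  define q where "q x = (\<Sum>i\<le>d. monom (dnx n (\<lambda>x. coeff (p x) i) x) i)" for x
  have cq: "coeff (q x) i = (if i \<le> d then dnx n (\<lambda>x. coeff (p x) i) x else 0)" for x i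
    unfolding q_def coeff_sum by (simp add: sum.delta)
  show ?thesis
  proof (rule repI[of q])
    show "Cinf_on I (\<lambda>x. coeff (q x) i)" for i
      by (cases "i \<le> d") (simp_all add: cq Cinf_on_const Cinf_on_dnx p(1))
    fix x assume x: "x \<in> I"
    show "degree (q x) \<le> d" by (rule degree_le) (simp add: cq)
    have "coeff (q x) d = dnx n (\<lambda>x. of_real (deval P u x)) x"
      using p(3) by (simp add: cq) (rule dnx_cong[OF oI _ x])
    also have "\<dots> = of_real (deval ((dD ^^ n) P) u x)"
      using dnx_linear[OF oI bounded_linear_of_real Cinf_on_deval[OF oI smooth_u] x]
        deval_dD_pow[OF oI smooth_u x] by simp
    finally show "coeff (q x) d = of_real (deval ((dD ^^ n) P) u x)" .
    show "coeff (q x) 0 = 0" if v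
    proof -
      have "coeff (q x) 0 = dnx n (\<lambda>x. 0) x"
        using p(4)[OF _ that] by (simp add: cq) (rule dnx_cong[OF oI _ x])
      then show ?thesis by (simp add: dnx_const)
    qed
    fix z :: complex assume z: "4 * rc < norm z"
    have "dnx n (F z) x = dnx n (\<lambda>x. \<Sum>i\<le>d. coeff (p x) i * (1 / z) ^ i) x"
      using p(5)[OF _ z] poly_eq_sum_le[OF p(2)] by (intro dnx_cong[OF oI _ x]) auto
    also have "\<dots> = (\<Sum>i\<le>d. dnx n (\<lambda>x. coeff (p x) i * (1 / z) ^ i) x)"
      by (intro dnx_sum[OF oI _ x] Cinf_on_mult[OF oI] p Cinf_on_const)
    also have "\<dots> = (\<Sum>i\<le>d. dnx n (\<lambda>x. coeff (p x) i) x * (1 / z) ^ i)"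
      by (intro sum.cong refl dnx_linear[OF oI bounded_linear_mult_left p(1) x])
    also have "\<dots> = poly (q x) (1 / z)"
      by (simp add: q_def poly_sum poly_monom)
    finally show "dnx n (F z) x = poly (q x) (1 / z)" .
  qed
qed

text \<open>With y = 1/z, \<open>G\<close> is y q(y), and q is divided by y - 1/(4 rc), a multiple
  of 1 - 4 rc y, with remainder \<open>\<kappa> x\<close>. As the tracked coefficient of
  \<open>G\<close> is 0, its degree is at most \<open>J\<close>, so \<open>H\<close> has degree
  below \<open>J\<close> and tracked coefficient 0 again.\<close>

lemma rep_divide:
  assumes "rep True G (Suc J) 0" "J \<ge> 1"
  shows "\<exists>H \<kappa>. rep True H J 0 \<and>
    (\<forall>z. \<forall>x\<in>I. 4 * rc < norm z \<longrightarrow> G z x = (1 - 4 * of_real rc / z) * H z x + \<kappa> x / z)"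
proof -
  obtain p where p: "rep_by p True G (Suc J) 0"
    using assms(1) unfolding rep_def by blast
  note p = rep_byD[OF p]
  define c :: complex where "c = 1 / (4 * of_real rc)"
  have c: "4 * of_real rc * c = 1" using rc by (simp add: c_def)
  define q where "q x = poly_shift 1 (p x)" for x
  define s where "s x = synthetic_div (q x) c" for x
  have cq: "coeff (q x) i = coeff (p x) (Suc i)" for x i
    by (simp add: q_def coeff_poly_shift)
  have pq: "p x = pCons 0 (q x)" if "x \<in> I" for x
    by (rule poly_eqI) (use p(4)[OF that] in \<open>simp add: coeff_pCons cq split: nat.split\<close>)
  have dq: "degree (q x) \<le> J - 1" if "x \<in> I" for x
  proof (rule degree_le, intro allI impI)
    fix i assume "J - 1 < i"
    then have "Suc i = Suc J \<or> degree (p x) < Suc i" using p(2)[OF that] assms(2) by linarith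
    then show "coeff (q x) i = 0" unfolding cq using p(3)[OF that] by (auto simp: coeff_eq_0)
  qed
  have ds: "degree (s x) \<le> J - 1 - 1" if "x \<in> I" for x
    using diff_le_mono[OF dq[OF that], of 1] by (simp add: s_def degree_synthetic_div)
  have cs: "coeff (s x) i = coeff (q x) (Suc i) + c * coeff (s x) (Suc i)" for x i
    using arg_cong[OF synthetic_div_correct'[of c "q x"], of "\<lambda>p. coeff p (Suc i)"]
    by (simp add: s_def algebra_simps)
  \<comment> \<open>Smoothness descends from index \<open>J\<close>, where the coefficient vanishes:
    by \<open>cs\<close> each coefficient of \<open>s\<close> comes from the next one and a
    coefficient of \<open>q\<close>.\<close>
  have "Cinf_on I (\<lambda>x. coeff (s x) (J - i))" for i
  proof (induction i)
    case 0
    have "coeff (s x) J = 0" if "x \<in> I" for x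
      using ds[OF that] assms(2) by (intro coeff_eq_0) auto
    then show ?case by (intro Cinf_on_cong[OF oI _ Cinf_on_const[of I 0]]) auto
  next
    case (Suc i)
    show ?case
    proof (cases "i < J")
      case True
      then have *: "Suc (J - Suc i) = J - i" by simp
      show ?thesis
        unfolding cs[of _ "J - Suc i"] * cq by (intro Cinf_on_plus Cinf_on_mult Cinf_on_const oI p Suc.IH)
    next
      case False
      then show ?thesis using Suc by simp
    qed
  qed
  then have smooth_le: "Cinf_on I (\<lambda>x. coeff (s x) i)" if "i \<le> J" for i
    by (metis diff_diff_cancel that)
  have smooth: "Cinf_on I (\<lambda>x. coeff (s x) i)" for i
  proof (cases "i \<le> J")
    case False
    have "coeff (s x) i = 0" if "x \<in> I" for x
      using ds[OF that] False by (intro coeff_eq_0) auto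
    then show ?thesis by (intro Cinf_on_cong[OF oI _ Cinf_on_const[of I 0]]) auto
  qed (rule smooth_le)
  define H where "H z x = poly (pCons 0 (smult (- c) (s x))) (1 / z)" for z x
  have "rep True H J 0"
  proof (rule repI[of "\<lambda>x. pCons 0 (smult (- c) (s x))"])
    show "Cinf_on I (\<lambda>x. coeff (pCons 0 (smult (- c) (s x))) i)" for i
      by (cases i) (simp_all add: Cinf_on_const Cinf_on_mult[OF oI Cinf_on_const smooth, of "-c", simplified])
    fix x assume x: "x \<in> I"
    show "degree (pCons 0 (smult (- c) (s x))) \<le> J"
      using degree_pCons_le[of 0 "smult (- c) (s x)"] degree_smult_le[of "-c" "s x"] ds[OF x] assms(2)
      by linarith
    \<comment> \<open>For \<open>J = 1\<close> the truncated bound \<open>J - 1 - 1\<close> does not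
      exclude index 0; there \<open>q x\<close> is constant and the quotient is zero.\<close>
    have "coeff (s x) (J - 1) = 0 \<or> J = 1"
      using ds[OF x] assms(2) by (cases "J = 1") (auto intro!: coeff_eq_0)
    moreover have "s x = 0 \<or> J \<noteq> 1"
      using dq[OF x] by (auto simp: s_def synthetic_div_eq_0_iff)
    ultimately have "coeff (s x) (J - 1) = 0" by auto
    then show "coeff (pCons 0 (smult (- c) (s x))) J = of_real (deval 0 u x)"
      using assms(2) by (cases J) auto
  qed (auto simp: H_def)
  moreover define \<kappa> where "\<kappa> x = poly (q x) c" for x
  have "G z x = (1 - 4 * of_real rc / z) * H z x + \<kappa> x / z"
    if z: "4 * rc < norm z" and x: "x \<in> I" for z x
  proof -
    have A: "poly (q x) (1 / z) = (1 / z - c) * poly (s x) (1 / z) + poly (q x) c"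
      using arg_cong[OF synthetic_div_correct'[of c "q x"], of "\<lambda>p. poly p (1 / z)"]
      by (simp add: s_def algebra_simps)
    have "(1 - 4 * of_real rc / z) * (- c) = 1 / z - c"
      using c by (simp add: algebra_simps)
    then have B: "(1 - 4 * of_real rc / z) * H z x = 1 / z * ((1 / z - c) * poly (s x) (1 / z))"
      unfolding H_def by (auto simp: algebra_simps)
    show ?thesis
      unfolding B \<kappa>_def using A p(5)[OF x z] pq[OF x] by (simp add: add_divide_distrib)
  qed
  ultimately show ?thesis by blast
qed

end

subsection \<open>Leading coefficients of the recursion\<close>

lemma sum_even_indices:
  "(\<Sum>k\<le>2 * J. if even k then f k else 0) = (\<Sum>j\<le>J. f (2 * j :: nat) :: 'a::comm_monoid_add)"
  by (induction J) auto

lemma sum_odd_indices: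
  "(\<Sum>k\<le>2 * Suc J. if odd k then f k else 0) = (\<Sum>j\<le>J. f (2 * j + 1 :: nat) :: 'a::comm_monoid_add)"
proof (induction J)
  case 0
  show ?case by (simp add: numeral_2_eq_2)
qed auto

lemma sum_all_indices:
  "(\<Sum>k\<le>2 * J + 1. f k) = (\<Sum>j\<le>J. f (2 * j :: nat) + f (2 * j + 1) :: 'a::comm_monoid_add)"
  by (induction J) (auto simp: add_ac)

text \<open>For \<open>c = - 1\<close> and \<open>c = 1\<close> these are the coefficients of the
  factors W + W^- and W + W^+ of the quadratic equation.\<close>

definition sym_sum :: "real \<Rightarrow> (nat \<Rightarrow> complex \<Rightarrow> real \<Rightarrow> complex) \<Rightarrow> nat \<Rightarrow> complex \<Rightarrow> real \<Rightarrow> complex" where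
  "sym_sum c F N z x = F N z x + shift_coeff (- 1) c (\<lambda>k. F k z) N x"

text \<open>The predicted coefficient of index \<open>(N + 1) div 2\<close> in order
  \<open>N\<close> of W.\<close>

definition top_resolvent :: "real \<Rightarrow> nat \<Rightarrow> dpoly" where
  "top_resolvent r N = (if even N then sigma r (N div 2) else rho r (N div 2))"

text \<open>With \<open>top_odd_fps\<close>, the generating series of the coefficients of index
  \<open>N div 2\<close> in \<open>sym_sum c\<close>, by parity of \<open>N\<close>. At odd orders
  W_N cancels against its reflection, which lowers the degree and lets second derivatives
  contribute.\<close>

definition top_even_fps :: "real \<Rightarrow> real \<Rightarrow> dpoly fps" where
  "top_even_fps r c = 2 * sigma_fps r - const_fps c * fps_X * dD_fps (rho_fps r)"

definition top_odd_fps :: "real \<Rightarrow> real \<Rightarrow> dpoly fps" where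
  "top_odd_fps r c = const_fps c * dD_fps (sigma_fps r) - const_fps (1 / 2) * fps_X * dD_fps (dD_fps (rho_fps r))"

definition top_sym :: "real \<Rightarrow> real \<Rightarrow> nat \<Rightarrow> dpoly" where
  "top_sym r c N = (if even N then top_even_fps r c $ (N div 2) else top_odd_fps r c $ (N div 2))"

text \<open>Unfolds the series into the terms of the Taylor shift that reach degree
  \<open>N div 2\<close>: those with no derivative, with one, and for odd \<open>N\<close> with
  two.\<close>

lemma top_sym_expand:
  assumes "c ^ 2 = 1"
  shows "top_sym r c N = (if even N then 2 * top_resolvent r N else 0)
    + (if 1 \<le> N then dconst ((- 1) ^ (N - 1) * c) * dD (top_resolvent r (N - 1)) else 0)
    + (if 2 \<le> N \<and> odd N then dconst (- 1 / 2) * dD (dD (top_resolvent r (N - 2))) else 0)"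
proof (cases "even N")
  case True
  then obtain J where N: "N = 2 * J" by (elim evenE)
  show ?thesis
  proof (cases J)
    case (Suc j)
    then have "N - 1 = Suc (2 * j)" using N by simp
    then show ?thesis
      unfolding top_sym_def top_resolvent_def top_even_fps_def N
      by (simp add: Suc sigma_fps_def rho_fps_def numeral_fps_const mult.assoc dconst_minus)
  qed (simp add: N top_sym_def top_resolvent_def top_even_fps_def sigma_fps_def numeral_fps_const mult.assoc)
next
  case False
  then obtain J where N: "N = 2 * J + 1" by (elim oddE)
  show ?thesis
  proof (cases J)
    case (Suc j)
    then have "N - 2 = Suc (2 * j)" using N by simp
    then show ?thesis
      unfolding top_sym_def top_resolvent_def top_odd_fps_def N
      by (simp add: Suc sigma_fps_def rho_fps_def mult.assoc dconst_minus)
  qed (simp add: N top_sym_def top_resolvent_def top_odd_fps_def sigma_fps_def mult.assoc)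
qed

definition top_sym_prod :: "real \<Rightarrow> nat \<Rightarrow> dpoly" where
  "top_sym_prod r N = (if even N then (top_even_fps r (-1) * top_even_fps r 1) $ (N div 2)
     else (top_even_fps r (-1) * top_odd_fps r 1 + top_odd_fps r (-1) * top_even_fps r 1) $ (N div 2))"

text \<open>The omitted pairs have two odd indices with even sum; rounding down twice loses one
  degree, so they do not reach \<open>N div 2\<close>.\<close>

lemma top_sym_prod_sum:
  "top_sym_prod r N = (\<Sum>k\<le>N. if even N \<and> odd k then 0 else top_sym r (-1) k * top_sym r 1 (N - k))"
proof (cases "even N")
  case True
  then obtain J where N: "N = 2 * J" by (elim evenE)
  have "(\<Sum>k\<le>N. if even N \<and> odd k then 0 else top_sym r (-1) k * top_sym r 1 (N - k))
    = (\<Sum>k\<le>2 * J. if even k then top_sym r (-1) k * top_sym r 1 (2 * J - k) else 0)"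
    unfolding N by (intro sum.cong) auto
  also have "\<dots> = (\<Sum>j\<le>J. top_sym r (-1) (2 * j) * top_sym r 1 (2 * J - 2 * j))"
    by (rule sum_even_indices)
  also have "\<dots> = (\<Sum>j\<le>J. top_even_fps r (-1) $ j * top_even_fps r 1 $ (J - j))"
    by (intro sum.cong) (auto simp: top_sym_def simp flip: diff_mult_distrib2)
  finally show ?thesis by (simp add: N top_sym_prod_def fps_mult_nth atLeast0AtMost)
next
  case False
  then obtain J where N: "N = 2 * J + 1" by (elim oddE)
  have "(\<Sum>k\<le>N. if even N \<and> odd k then 0 else top_sym r (-1) k * top_sym r 1 (N - k))
    = (\<Sum>k\<le>2 * J + 1. top_sym r (-1) k * top_sym r 1 (2 * J + 1 - k))"
    unfolding N by (intro sum.cong) auto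
  also have "\<dots> = (\<Sum>j\<le>J. top_sym r (-1) (2 * j) * top_sym r 1 (2 * J + 1 - 2 * j)
      + top_sym r (-1) (2 * j + 1) * top_sym r 1 (2 * J + 1 - (2 * j + 1)))"
    by (rule sum_all_indices)
  also have "\<dots> = (\<Sum>j\<le>J. top_even_fps r (-1) $ j * top_odd_fps r 1 $ (J - j) + top_odd_fps r (-1) $ j * top_even_fps r 1 $ (J - j))"
  proof (intro sum.cong refl)
    fix j assume "j \<in> {..J}"
    then have "2 * J + 1 - 2 * j = 2 * (J - j) + 1" "2 * J + 1 - (2 * j + 1) = 2 * (J - j)" by auto
    then show "top_sym r (-1) (2 * j) * top_sym r 1 (2 * J + 1 - 2 * j)
      + top_sym r (-1) (2 * j + 1) * top_sym r 1 (2 * J + 1 - (2 * j + 1))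
      = top_even_fps r (-1) $ j * top_odd_fps r 1 $ (J - j) + top_odd_fps r (-1) $ j * top_even_fps r 1 $ (J - j)"
      unfolding top_sym_def by simp
  qed
  finally show ?thesis by (simp add: N top_sym_prod_def fps_mult_nth atLeast0AtMost sum.distrib)
qed

text \<open>The factor u sits at order 1 of \<open>a\<close>; giving up one order costs no degree
  only when \<open>N\<close> is odd.\<close>

definition top_triple :: "real \<Rightarrow> nat \<Rightarrow> dpoly" where
  "top_triple r N = dconst r * top_sym_prod r N + (if odd N then dvar 0 * top_sym_prod r (N - 1) else 0)"

text \<open>Refers to degree \<open>Suc (N div 2)\<close>, which for even \<open>N\<close> is
  reached only by pairs of odd indices, where both degrees are rounded up.\<close>

definition top_square :: "real \<Rightarrow> nat \<Rightarrow> dpoly" where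
  "top_square r N = (\<Sum>k\<le>N. if even N \<and> even k then 0 else top_resolvent r k * top_resolvent r (N - k))"

lemma top_square_even: "top_square r (2 * J) = (fps_X * rho_fps r ^ 2) $ J"
proof (cases J)
  case (Suc i)
  have "top_square r (2 * J) = (\<Sum>k\<le>2 * Suc i. if odd k then top_resolvent r k * top_resolvent r (2 * Suc i - k) else 0)"
    unfolding top_square_def Suc by (intro sum.cong) auto
  also have "\<dots> = (\<Sum>j\<le>i. top_resolvent r (2 * j + 1) * top_resolvent r (2 * Suc i - (2 * j + 1)))"
    by (rule sum_odd_indices)
  also have "\<dots> = (\<Sum>j\<le>i. rho r j * rho r (i - j))"
  proof (intro sum.cong refl)
    fix j assume "j \<in> {..i}"
    then have "2 * Suc i - (2 * j + 1) = 2 * (i - j) + 1" by auto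
    then show "top_resolvent r (2 * j + 1) * top_resolvent r (2 * Suc i - (2 * j + 1)) = rho r j * rho r (i - j)"
      unfolding top_resolvent_def by simp
  qed
  also have "\<dots> = (rho_fps r * rho_fps r) $ i"
    by (simp add: fps_mult_nth rho_fps_def atLeast0AtMost)
  finally show ?thesis by (simp add: Suc power2_eq_square)
qed (simp add: top_square_def)

lemma top_square_odd: "top_square r (2 * J + 1) = (2 * rho_fps r * sigma_fps r) $ J"
proof -
  have "top_square r (2 * J + 1) = (\<Sum>k\<le>2 * J + 1. top_resolvent r k * top_resolvent r (2 * J + 1 - k))"
    unfolding top_square_def by (intro sum.cong) auto
  also have "\<dots> = (\<Sum>j\<le>J. top_resolvent r (2 * j) * top_resolvent r (2 * J + 1 - 2 * j)
      + top_resolvent r (2 * j + 1) * top_resolvent r (2 * J + 1 - (2 * j + 1)))"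
    by (rule sum_all_indices)
  also have "\<dots> = (\<Sum>j\<le>J. sigma r j * rho r (J - j) + rho r j * sigma r (J - j))"
  proof (intro sum.cong refl)
    fix j assume "j \<in> {..J}"
    then have "2 * J + 1 - 2 * j = 2 * (J - j) + 1" "2 * J + 1 - (2 * j + 1) = 2 * (J - j)" by auto
    then show "top_resolvent r (2 * j) * top_resolvent r (2 * J + 1 - 2 * j)
      + top_resolvent r (2 * j + 1) * top_resolvent r (2 * J + 1 - (2 * j + 1)) = sigma r j * rho r (J - j) + rho r j * sigma r (J - j)"
      unfolding top_resolvent_def by simp
  qed
  also have "\<dots> = (sigma_fps r * rho_fps r + rho_fps r * sigma_fps r) $ J"
    unfolding fps_add_nth fps_mult_nth sum.distrib by (simp add: sigma_fps_def rho_fps_def atLeast0AtMost)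
  also have "sigma_fps r * rho_fps r + rho_fps r * sigma_fps r = 2 * rho_fps r * sigma_fps r" by simp
  finally show ?thesis .
qed

text \<open>Even orders are coefficients of \<open>sigma_fps_quadratic\<close>, odd orders of
  \<open>sigma_fps_second\<close>. The constant \<open>4 * r\<close> enters only at order 0, hence
  the restriction on \<open>N\<close>.\<close>

lemma top_cancel:
  assumes "r > 0" "N \<ge> 1"
  shows "top_triple r N = top_square r N"
proof -
  have aa: "top_even_fps r (-1) * top_even_fps r 1 = 4 * sigma_fps r ^ 2 - fps_X ^ 2 * dD_fps (rho_fps r) ^ 2"
    by (simp add: top_even_fps_def dconst_minus algebra_simps power2_eq_square flip: fps_const_neg)
  show ?thesis
  proof (cases "even N")
    case True
    then obtain J where N: "N = 2 * J" by (elim evenE)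
    have "top_triple r N = (const_fps r * (4 * sigma_fps r ^ 2 - fps_X ^ 2 * dD_fps (rho_fps r) ^ 2)) $ J"
      unfolding top_triple_def top_sym_prod_def N aa by simp
    also have "\<dots> = (fps_X * rho_fps r ^ 2 + const_fps (4 * r)) $ J"
      using sigma_fps_quadratic[of r] assms by simp
    finally show ?thesis
      using assms(2) by (simp add: N top_square_even)
  next
    case False
    then obtain J where N: "N = 2 * J + 1" by (elim oddE)
    have half: "2 * const_fps (1 / 2) = 1"
      by (simp only: const_fps_numeral[symmetric] const_fps_mult[symmetric]) simp
    have "top_even_fps r (-1) * top_odd_fps r 1 + top_odd_fps r (-1) * top_even_fps r 1
        = 2 * fps_X * dD_fps (rho_fps r) * dD_fps (sigma_fps r) - 2 * (2 * const_fps (1/2)) * fps_X * sigma_fps r * dD_fps (dD_fps (rho_fps r))"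
      by (simp add: top_even_fps_def top_odd_fps_def dconst_minus algebra_simps flip: fps_const_neg)
    then have ao: "top_even_fps r (-1) * top_odd_fps r 1 + top_odd_fps r (-1) * top_even_fps r 1
        = 2 * fps_X * (dD_fps (rho_fps r) * dD_fps (sigma_fps r) - sigma_fps r * dD_fps (dD_fps (rho_fps r)))"
      unfolding half by (simp add: algebra_simps)
    have "top_triple r N = (const_fps r * (2 * fps_X * (dD_fps (rho_fps r) * dD_fps (sigma_fps r) - sigma_fps r * dD_fps (dD_fps (rho_fps r))))
        + u_fps * (4 * sigma_fps r ^ 2 - fps_X ^ 2 * dD_fps (rho_fps r) ^ 2)) $ J"
      unfolding top_triple_def top_sym_prod_def N aa ao by simp
    also have "const_fps r * (2 * fps_X * (dD_fps (rho_fps r) * dD_fps (sigma_fps r) - sigma_fps r * dD_fps (dD_fps (rho_fps r))))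
        + u_fps * (4 * sigma_fps r ^ 2 - fps_X ^ 2 * dD_fps (rho_fps r) ^ 2) = 2 * rho_fps r * sigma_fps r"
      using sigma_fps_second[of r] assms by (simp add: algebra_simps)
    finally show ?thesis
      unfolding N top_square_odd .
  qed
qed

section \<open>Degrees and top coefficients of the products\<close>

context double_scaling
begin

lemma rep_sym_sum:
  assumes F: "\<And>k. k \<le> N \<Longrightarrow> rep False (F k) ((k + 1) div 2) (top_resolvent rc k)" and c: "c ^ 2 = 1"
  shows "rep False (sym_sum c F N) (N div 2) (top_sym rc c N)"
proof -
  define e where "e n = (- 1) ^ (N - n) * c ^ n / fact n" for n
  define T where "T n = (if n = 1 then dconst ((- 1) ^ (N - 1) * c) * dD (top_resolvent rc (N - 1)) else 0)
    + (if n = 2 then if odd N then dconst (- 1 / 2) * dD (dD (top_resolvent rc (N - 2))) else 0 else 0)" for n :: nat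
  \<comment> \<open>For odd \<open>N\<close> one has \<open>e 0 = - 1\<close>: the undifferentiated
    terms cancel, so the larger degree of \<open>F N\<close> does not appear.\<close>
  have "rep False (\<lambda>z x. F N z x + of_real (e 0) * F N z x) (N div 2) (if even N then 2 * top_resolvent rc N else 0)"
  proof (cases "even N")
    case True
    then have "rep False (F N) (N div 2) (top_resolvent rc N)" using F[of N] by simp
    from rep_scale[OF this, of 2] show ?thesis
      using True by (simp add: e_def)
  qed (simp add: e_def rep_zero)
  moreover have "rep False (\<lambda>z x. \<Sum>n\<in>{1..N}. of_real (e n) * dnx n (F (N - n) z) x) (N div 2) (\<Sum>n\<in>{1..N}. T n)"
  proof (rule rep_sum)
    fix n assume n: "n \<in> {1..N}"
    have R: "rep False (\<lambda>z x. of_real (e n) * dnx n (F (N - n) z) x) ((N - n + 1) div 2)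
        (dconst (e n) * (dD ^^ n) (top_resolvent rc (N - n)))"
      by (rule rep_scale[OF rep_dnx[OF F]]) simp
    consider "n = 1" | "n = 2" "odd N" | "(N - n + 1) div 2 < N div 2" "n \<noteq> 1" "n = 2 \<longrightarrow> even N"
      using n by (cases "n = 1"; cases "n = 2"; cases "odd N") (auto elim!: evenE oddE)
    then show "rep False (\<lambda>z x. of_real (e n) * dnx n (F (N - n) z) x) (N div 2) (T n)"
    proof cases
      case 1
      then show ?thesis using R n by (simp add: T_def e_def)
    next
      case 2
      have "(N - n + 1) div 2 = N div 2" using 2 n by (auto elim!: oddE)
      moreover have "e n = - 1 / 2" using 2 n c by (simp add: e_def)
      ultimately show ?thesis using R 2 by (simp add: T_def numeral_2_eq_2)
    next
      case 3
      then have "T n = 0" by (auto simp: T_def)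
      then show ?thesis using rep_weaken[OF R 3(1)] by simp
    qed
  qed
  ultimately have "rep False (\<lambda>z x. (F N z x + of_real (e 0) * F N z x)
        + (\<Sum>n\<in>{1..N}. of_real (e n) * dnx n (F (N - n) z) x)) (N div 2)
      ((if even N then 2 * top_resolvent rc N else 0) + (\<Sum>n\<in>{1..N}. T n))"
    by (rule rep_add)
  moreover have "(if even N then 2 * top_resolvent rc N else 0) + (\<Sum>n\<in>{1..N}. T n) = top_sym rc c N"
    unfolding top_sym_expand[OF c] T_def sum.distrib by (simp add: sum.delta)
  moreover have "sym_sum c F N z x = (F N z x + of_real (e 0) * F N z x)
        + (\<Sum>n\<in>{1..N}. of_real (e n) * dnx n (F (N - n) z) x)" for z x
  proof -
    have "{..N} = insert 0 {1..N}" by auto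
    then show ?thesis by (simp add: sym_sum_def shift_coeff_def e_def)
  qed
  ultimately show ?thesis by (simp add: rep_cong)
qed

lemma rep_sym_prod:
  assumes F: "\<And>k. k \<le> N \<Longrightarrow> rep False (F k) ((k + 1) div 2) (top_resolvent rc k)"
  shows "rep False (\<lambda>z x. \<Sum>k\<le>N. sym_sum (-1) F k z x * sym_sum 1 F (N - k) z x) (N div 2) (top_sym_prod rc N)"
  unfolding top_sym_prod_sum
proof (rule rep_sum)
  fix k assume k: "k \<in> {..N}"
  have R: "rep False (\<lambda>z x. sym_sum (-1) F k z x * sym_sum 1 F (N - k) z x) (k div 2 + (N - k) div 2)
      (top_sym rc (-1) k * top_sym rc 1 (N - k))"
    using rep_mult[OF rep_sym_sum[of k F "-1"] rep_sym_sum[of "N - k" F 1]] F k by simp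
  show "rep False (\<lambda>z x. sym_sum (-1) F k z x * sym_sum 1 F (N - k) z x) (N div 2)
      (if even N \<and> odd k then 0 else top_sym rc (-1) k * top_sym rc 1 (N - k))"
  proof (cases "even N \<and> odd k")
    case True
    then have "k div 2 + (N - k) div 2 < N div 2" using k by (auto elim!: evenE oddE)
    then show ?thesis using rep_weaken[OF R] True by simp
  next
    case False
    then have "k div 2 + (N - k) div 2 = N div 2" using k
      by (cases "even N"; cases "even k") (auto elim!: evenE oddE)
    then show ?thesis using R False by auto
  qed
qed

lemma rep_triple:
  assumes F: "\<And>k. k \<le> N \<Longrightarrow> rep False (F k) ((k + 1) div 2) (top_resolvent rc k)"
    and a: "\<And>k. Cinf_on I (a k)" "\<And>x. x \<in> I \<Longrightarrow> a 0 x = rc" "\<And>x. x \<in> I \<Longrightarrow> a 1 x = u x"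
  shows "rep False (\<lambda>z x. \<Sum>i\<le>N. of_real (a i x) * (\<Sum>k\<le>N - i. sym_sum (-1) F k z x * sym_sum 1 F (N - i - k) z x))
    (N div 2) (top_triple rc N)"
proof -
  define T where "T i = (if i = 0 then dconst rc * top_sym_prod rc N else 0)
    + (if i = 1 then if odd N then dvar 0 * top_sym_prod rc (N - 1) else 0 else 0)" for i :: nat
  have "rep False (\<lambda>z x. \<Sum>i\<le>N. of_real (a i x) * (\<Sum>k\<le>N - i. sym_sum (-1) F k z x * sym_sum 1 F (N - i - k) z x))
    (N div 2) (\<Sum>i\<le>N. T i)"
  proof (rule rep_sum)
    fix i assume i: "i \<in> {..N}"
    have R: "rep False (\<lambda>z x. \<Sum>k\<le>N - i. sym_sum (-1) F k z x * sym_sum 1 F (N - i - k) z x) ((N - i) div 2) (top_sym_prod rc (N - i))"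
      using F by (intro rep_sym_prod) simp
    have R0: "rep False (\<lambda>z x. of_real (a i x) * (\<Sum>k\<le>N - i. sym_sum (-1) F k z x * sym_sum 1 F (N - i - k) z x))
        ((N - i) div 2) (P * top_sym_prod rc (N - i))" if "\<And>x. x \<in> I \<Longrightarrow> a i x = deval P u x" for P
      using rep_mult[OF rep_smooth(2)[OF a(1) that] R] by simp
    consider "i = 0" | "i = 1" | "i \<ge> 2" by linarith
    then show "rep False (\<lambda>z x. of_real (a i x) * (\<Sum>k\<le>N - i. sym_sum (-1) F k z x * sym_sum 1 F (N - i - k) z x))
        (N div 2) (T i)"
    proof cases
      case 1
      then show ?thesis using R0[of "dconst rc"] a(2) by (simp add: T_def)
    next
      case 2
      have *: "rep False (\<lambda>z x. of_real (a i x) * (\<Sum>k\<le>N - i. sym_sum (-1) F k z x * sym_sum 1 F (N - i - k) z x))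
          ((N - i) div 2) (dvar 0 * top_sym_prod rc (N - i))"
        using R0[of "dvar 0"] a(3) 2 by simp
      show ?thesis
      proof (cases "odd N")
        case True
        then have "(N - i) div 2 = N div 2" using 2 by (auto elim!: oddE)
        then show ?thesis using * True 2 by (simp add: T_def)
      next
        case False
        then have "(N - i) div 2 < N div 2" using 2 i by (auto elim!: evenE)
        from rep_weaken[OF * this] show ?thesis using False 2 by (simp add: T_def)
      qed
    next
      case 3
      \<comment> \<open>The nominal degree 1 of \<open>a i\<close> is paid for by the at least two
        orders it takes from the product.\<close>
      have "rep False (\<lambda>z x. of_real (a i x) * (\<Sum>k\<le>N - i. sym_sum (-1) F k z x * sym_sum 1 F (N - i - k) z x))
          (1 + (N - i) div 2) (0 * top_sym_prod rc (N - i))"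
        using rep_mult[OF rep_smooth(1)[OF a(1)] R] by simp
      then have "rep False (\<lambda>z x. of_real (a i x) * (\<Sum>k\<le>N - i. sym_sum (-1) F k z x * sym_sum 1 F (N - i - k) z x))
          (N div 2) 0"
        using 3 i by (auto intro: rep_weaken_le)
      then show ?thesis using 3 by (simp add: T_def)
    qed
  qed
  moreover have "(\<Sum>i\<le>N. T i) = top_triple rc N"
    unfolding T_def sum.distrib top_triple_def by (cases N) (auto simp: sum.delta)
  ultimately show ?thesis by simp
qed

text \<open>Order \<open>N\<close> of y a (W + W^-) (W + W^+) - W^2 with y = 1/z. The remaining term
  - 1 + 4 rc y of the quadratic equation has order 0, so at orders \<open>N \<ge> 1\<close> the
  equation says that \<open>Phi\<close> vanishes.\<close>

definition Phi :: "(nat \<Rightarrow> real \<Rightarrow> real) \<Rightarrow> (nat \<Rightarrow> complex \<Rightarrow> real \<Rightarrow> complex) \<Rightarrow> nat \<Rightarrow> complex \<Rightarrow> real \<Rightarrow> complex" where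
  "Phi a F N z x =
     1 / z * (\<Sum>i\<le>N. of_real (a i x) * (\<Sum>k\<le>N - i. sym_sum (-1) F k z x * sym_sum 1 F (N - i - k) z x))
     - (\<Sum>k\<le>N. F k z x * F (N - k) z x)"

text \<open>Both terms have degree at most \<open>Suc (N div 2)\<close> and, by
  \<open>top_cancel\<close>, the same top coefficient. This cancellation keeps the degrees from
  growing along the recursion.\<close>

lemma rep_Phi:
  assumes F: "\<And>k. k \<le> N \<Longrightarrow> rep (k \<ge> 1) (F k) ((k + 1) div 2) (top_resolvent rc k)"
    and a: "\<And>k. Cinf_on I (a k)" "\<And>x. x \<in> I \<Longrightarrow> a 0 x = rc" "\<And>x. x \<in> I \<Longrightarrow> a 1 x = u x"
    and N: "N \<ge> 1"
  shows "rep True (Phi a F N) (Suc (N div 2)) 0"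
proof -
  have 1: "rep True (\<lambda>z x. 1 / z * (\<Sum>i\<le>N. of_real (a i x) * (\<Sum>k\<le>N - i. sym_sum (-1) F k z x * sym_sum 1 F (N - i - k) z x)))
      (Suc (N div 2)) (top_triple rc N)"
    by (rule rep_inverse_mult[OF rep_triple[OF rep_weaken_v[OF F] a]])
  have 2: "rep True (\<lambda>z x. \<Sum>k\<le>N. F k z x * F (N - k) z x) (Suc (N div 2)) (top_square rc N)"
    unfolding top_square_def
  proof (rule rep_sum)
    fix k assume k: "k \<in> {..N}"
    have v: "(k \<ge> 1 \<or> N - k \<ge> 1) = True" using N by auto
    have R: "rep True (\<lambda>z x. F k z x * F (N - k) z x) ((k + 1) div 2 + (N - k + 1) div 2)
        (top_resolvent rc k * top_resolvent rc (N - k))"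
      using rep_mult[OF F[of k] F[of "N - k"]] k unfolding v by simp
    show "rep True (\<lambda>z x. F k z x * F (N - k) z x) (Suc (N div 2))
        (if even N \<and> even k then 0 else top_resolvent rc k * top_resolvent rc (N - k))"
    proof (cases "even N \<and> even k")
      case True
      then have "(k + 1) div 2 + (N - k + 1) div 2 < Suc (N div 2)" using k by (auto elim!: evenE)
      then show ?thesis using rep_weaken[OF R] True by simp
    next
      case False
      then have "(k + 1) div 2 + (N - k + 1) div 2 = Suc (N div 2)" using k
        by (cases "even N"; cases "even k") (auto elim!: evenE oddE)
      then show ?thesis using R False by auto
    qed
  qed
  have "rep True (\<lambda>z x. 1 / z * (\<Sum>i\<le>N. of_real (a i x) * (\<Sum>k\<le>N - i. sym_sum (-1) F k z x * sym_sum 1 F (N - i - k) z x))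
      + of_real (- 1) * (\<Sum>k\<le>N. F k z x * F (N - k) z x)) (Suc (N div 2)) (top_triple rc N + dconst (- 1) * top_square rc N)"
    by (intro rep_add rep_scale 1 2)
  moreover have "top_triple rc N + dconst (- 1) * top_square rc N = 0"
    using top_cancel[OF rc N] by (simp add: dconst_minus)
  ultimately show ?thesis
    by (simp add: Phi_def[abs_def])
qed

end

subsection \<open>Solving the recursion order by order\<close>

lemma fps_agree_below:
  fixes A B :: "complex fps"
  assumes "\<And>k. k < N \<Longrightarrow> A $ k = B $ k"
  obtains E where "A = B + fps_X ^ N * E" "E $ 0 = A $ N - B $ N" "E $ 1 = A $ Suc N - B $ Suc N"
proof
  show "A = B + fps_X ^ N * fps_shift N (A - B)"
    by (rule fps_ext) (use assms in \<open>auto simp: fps_X_power_mult_nth\<close>)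
qed auto

text \<open>The product of the two differences starts at order \<open>2 * N\<close>: it is invisible
  at order \<open>N\<close>, and also at \<open>Suc N\<close> once \<open>N \<ge> 2\<close>. Only
  linear terms remain.\<close>

lemma fps_triple_diff:
  fixes a A B A' B' :: "complex fps"
  assumes A: "\<And>k. k < N \<Longrightarrow> A $ k = A' $ k" and B: "\<And>k. k < N \<Longrightarrow> B $ k = B' $ k" and N: "N \<ge> 1"
  shows "(a * A * B) $ N - (a * A' * B') $ N
      = a $ 0 * ((A $ N - A' $ N) * B' $ 0 + A' $ 0 * (B $ N - B' $ N))"
    and "N \<ge> 2 \<Longrightarrow> (a * A * B) $ Suc N - (a * A' * B') $ Suc N
      = a $ 0 * ((A $ Suc N - A' $ Suc N) * B' $ 0 + (A $ N - A' $ N) * B' $ 1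
          + A' $ 1 * (B $ N - B' $ N) + A' $ 0 * (B $ Suc N - B' $ Suc N))
        + a $ 1 * ((A $ N - A' $ N) * B' $ 0 + A' $ 0 * (B $ N - B' $ N))"
proof -
  obtain E where E: "A = A' + fps_X ^ N * E" "E $ 0 = A $ N - A' $ N" "E $ 1 = A $ Suc N - A' $ Suc N"
    using fps_agree_below[OF A] by metis
  obtain E' where E': "B = B' + fps_X ^ N * E'" "E' $ 0 = B $ N - B' $ N" "E' $ 1 = B $ Suc N - B' $ Suc N"
    using fps_agree_below[OF B] by metis
  have "a * A * B - a * A' * B' = fps_X ^ N * (a * (E * B' + A' * E') + fps_X ^ N * (a * E * E'))"
    by (subst E(1), subst E'(1)) (simp add: algebra_simps)
  then have *: "(a * A * B) $ k - (a * A' * B') $ k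
      = (fps_X ^ N * (a * (E * B' + A' * E') + fps_X ^ N * (a * E * E'))) $ k" for k
    by (metis fps_sub_nth)
  show "(a * A * B) $ N - (a * A' * B') $ N
      = a $ 0 * ((A $ N - A' $ N) * B' $ 0 + A' $ 0 * (B $ N - B' $ N))"
    unfolding * E(2)[symmetric] E'(2)[symmetric] using N by (simp add: fps_X_power_mult_nth)
  show "(a * A * B) $ Suc N - (a * A' * B') $ Suc N
      = a $ 0 * ((A $ Suc N - A' $ Suc N) * B' $ 0 + (A $ N - A' $ N) * B' $ 1
          + A' $ 1 * (B $ N - B' $ N) + A' $ 0 * (B $ Suc N - B' $ Suc N))
        + a $ 1 * ((A $ N - A' $ N) * B' $ 0 + A' $ 0 * (B $ N - B' $ N))" if "N \<ge> 2"
  proof -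
    have shift: "(fps_X ^ N * (K + fps_X ^ N * J)) $ Suc N = K $ 1" for K J :: "complex fps"
      using that by (simp add: fps_X_power_mult_nth)
    show ?thesis
      unfolding * shift E(2,3)[symmetric] E'(2,3)[symmetric]
      by (simp add: fps_mult_nth_1 algebra_simps del: One_nat_def)
  qed
qed

definition seq_fps :: "(nat \<Rightarrow> complex \<Rightarrow> real \<Rightarrow> complex) \<Rightarrow> complex \<Rightarrow> real \<Rightarrow> complex fps" where
  "seq_fps F z x = Abs_fps (\<lambda>k. F k z x)"

definition coeff_fps :: "(nat \<Rightarrow> real \<Rightarrow> real) \<Rightarrow> real \<Rightarrow> complex fps" where
  "coeff_fps a x = Abs_fps (\<lambda>k. of_real (a k x))"

context double_scaling
begin

lemma Phi_fps:
  "Phi a F N z x = 1 / z * (coeff_fps a x * seq_fps (sym_sum (-1) F) z x * seq_fps (sym_sum 1 F) z x) $ N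
     - (1 * seq_fps F z x * seq_fps F z x) $ N"
  unfolding Phi_def mult.assoc[of "coeff_fps a x"] mult_1 fps_mult_nth
  by (simp add: seq_fps_def coeff_fps_def atLeast0AtMost)

lemma shift_coeff_split:
  "shift_coeff (- 1) c (\<lambda>k. F k z) N x = (- 1) ^ N * F N z x
     + (\<Sum>n\<in>{1..N}. of_real ((- 1) ^ (N - n) * c ^ n / fact n) * dnx n (F (N - n) z) x)"
proof -
  have "{..N} = insert 0 {1..N}" by auto
  then show ?thesis by (simp add: shift_coeff_def)
qed

text \<open>Agreement on all of \<open>I\<close>, not just at \<open>x\<close>, makes the
  derivatives of the lower orders agree. Order \<open>N\<close> then enters at order
  \<open>Suc N\<close> only through its first derivative.\<close>

lemma sym_sum_agree:
  assumes "\<And>k y. k < N \<Longrightarrow> y \<in> I \<Longrightarrow> F k z y = G k z y" "x \<in> I"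
  shows "M < N \<Longrightarrow> sym_sum c F M z x = sym_sum c G M z x"
    and "sym_sum c F N z x - sym_sum c G N z x = (1 + (- 1) ^ N) * (F N z x - G N z x)"
    and "sym_sum c F (Suc N) z x - sym_sum c G (Suc N) z x = (1 - (- 1) ^ N) * (F (Suc N) z x - G (Suc N) z x)
      + (- 1) ^ N * of_real c * (dnx 1 (F N z) x - dnx 1 (G N z) x)"
proof -
  have eq: "dnx n (F k z) x = dnx n (G k z) x" if "k < N" for n k
    using assms(1)[OF that] by (rule dnx_cong[OF oI _ assms(2)])
  show "sym_sum c F M z x = sym_sum c G M z x" if "M < N"
    using that assms unfolding sym_sum_def shift_coeff_def
    by (intro arg_cong2[of _ _ _ _ "(+)"] sum.cong refl) (auto simp: eq)
  have "(\<Sum>n\<in>{1..N}. of_real ((- 1) ^ (N - n) * c ^ n / fact n) * dnx n (F (N - n) z) x)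
      = (\<Sum>n\<in>{1..N}. of_real ((- 1) ^ (N - n) * c ^ n / fact n) * dnx n (G (N - n) z) x)"
    by (intro sum.cong refl) (auto simp: eq)
  then show "sym_sum c F N z x - sym_sum c G N z x = (1 + (- 1) ^ N) * (F N z x - G N z x)"
    unfolding sym_sum_def shift_coeff_split by (simp add: algebra_simps)
  have *: "(\<Sum>n\<in>{1..Suc N}. of_real ((- 1) ^ (Suc N - n) * c ^ n / fact n) * dnx n (H (Suc N - n) z) x)
      = (- 1) ^ N * of_real c * dnx 1 (H N z) x
        + (\<Sum>n\<in>{2..Suc N}. of_real ((- 1) ^ (Suc N - n) * c ^ n / fact n) * dnx n (H (Suc N - n) z) x)" for H
  proof -
    have "{1..Suc N} = insert 1 {2..Suc N}" by auto
    then show ?thesis by simp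
  qed
  have "(\<Sum>n\<in>{2..Suc N}. of_real ((- 1) ^ (Suc N - n) * c ^ n / fact n) * dnx n (F (Suc N - n) z) x)
      = (\<Sum>n\<in>{2..Suc N}. of_real ((- 1) ^ (Suc N - n) * c ^ n / fact n) * dnx n (G (Suc N - n) z) x)"
    by (intro sum.cong refl) (auto simp: eq)
  then show "sym_sum c F (Suc N) z x - sym_sum c G (Suc N) z x = (1 - (- 1) ^ N) * (F (Suc N) z x - G (Suc N) z x)
      + (- 1) ^ N * of_real c * (dnx 1 (F N z) x - dnx 1 (G N z) x)"
    unfolding sym_sum_def shift_coeff_split * by (simp add: algebra_simps)
qed

lemma sym_sum_low:
  assumes "\<And>y. y \<in> I \<Longrightarrow> G 0 z y = 1" "x \<in> I"
  shows "sym_sum c G 0 z x = 2" "sym_sum c G 1 z x = 0"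
proof -
  have "dnx 1 (G 0 z) x = dnx 1 (\<lambda>_. 1) x"
    using assms(1) by (rule dnx_cong[OF oI _ assms(2)])
  then show "sym_sum c G 1 z x = 0"
    by (simp add: sym_sum_def shift_coeff_def dnx_const)
qed (use assms in \<open>simp add: sym_sum_def shift_coeff_def\<close>)

text \<open>The factor at order \<open>N\<close> is - 2 for odd \<open>N\<close> and - 2 (1 - 4 rc /
  z) for even \<open>N\<close>, so only even orders need a division. At order \<open>Suc N\<close>
  the derivatives of the difference carry \<open>c = - 1\<close> and \<open>c = 1\<close> and
  cancel.\<close>

lemma Phi_diff:
  assumes agree: "\<And>k y. k < N \<Longrightarrow> y \<in> I \<Longrightarrow> F k z y = G k z y" and x: "x \<in> I"
    and G0: "\<And>y. y \<in> I \<Longrightarrow> G 0 z y = 1" and a0: "a 0 x = rc" and N: "N \<ge> 1"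
  shows "Phi a F N z x - Phi a G N z x
      = ((if even N then 8 * of_real rc / z else 0) - 2) * (F N z x - G N z x)"
    and "N \<ge> 2 \<Longrightarrow> even N \<Longrightarrow> Phi a F (Suc N) z x - Phi a G (Suc N) z x
      = (8 * of_real (a 1 x) / z - 2 * G 1 z x) * (F N z x - G N z x) - 2 * (F (Suc N) z x - G (Suc N) z x)"
proof -
  have A: "sym_sum c F M z x = sym_sum c G M z x" if "M < N" for c M
    by (rule sym_sum_agree(1)[OF _ x that]) (rule agree)
  have A2: "sym_sum c F N z x - sym_sum c G N z x = (1 + (- 1) ^ N) * (F N z x - G N z x)" for c
    by (rule sym_sum_agree(2)[OF _ x]) (rule agree)
  have A3: "sym_sum c F (Suc N) z x - sym_sum c G (Suc N) z x = (1 - (- 1) ^ N) * (F (Suc N) z x - G (Suc N) z x)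
      + (- 1) ^ N * of_real c * (dnx 1 (F N z) x - dnx 1 (G N z) x)" for c
    by (rule sym_sum_agree(3)[OF _ x]) (rule agree)
  let ?T = "\<lambda>F k. (coeff_fps a x * seq_fps (sym_sum (-1) F) z x * seq_fps (sym_sum 1 F) z x) $ k"
  let ?Q = "\<lambda>F k. (1 * seq_fps F z x * seq_fps F z x) $ k"
  have below: "seq_fps (sym_sum c F) z x $ k = seq_fps (sym_sum c G) z x $ k" "seq_fps F z x $ k = seq_fps G z x $ k"
    if "k < N" for c k
    using A agree x that by (simp_all add: seq_fps_def)
  note T = fps_triple_diff[of N "seq_fps (sym_sum (-1) F) z x" "seq_fps (sym_sum (-1) G) z x" "seq_fps (sym_sum 1 F) z x"
      "seq_fps (sym_sum 1 G) z x" "coeff_fps a x"]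
    and Q = fps_triple_diff[of N "seq_fps F z x" "seq_fps G z x" "seq_fps F z x" "seq_fps G z x" 1]
  have nth: "seq_fps F z x $ k = F k z x" for F k by (simp add: seq_fps_def)
  have a: "coeff_fps a x $ 0 = of_real rc" "coeff_fps a x $ 1 = of_real (a 1 x)"
    using a0 by (auto simp: coeff_fps_def)
  have low: "sym_sum c G 0 z x = 2" "sym_sum c G 1 z x = 0" for c
    using sym_sum_low(1)[where G = G and z = z and c = c, OF _ x] sym_sum_low(2)[where G = G and z = z and c = c, OF _ x] G0
    by blast+
  have lin: "1 / z * s - q - (1 / z * s' - q') = 1 / z * (s - s') - (q - q')" for s s' q q' :: complex
    by (simp add: algebra_simps diff_divide_distrib)
  show "Phi a F N z x - Phi a G N z x
      = ((if even N then 8 * of_real rc / z else 0) - 2) * (F N z x - G N z x)"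
  proof -
    have "?T F N - ?T G N = of_real rc * ((1 + (- 1) ^ N) * (F N z x - G N z x) * 2
        + 2 * ((1 + (- 1) ^ N) * (F N z x - G N z x)))"
      using T(1)[OF below(1) below(1) N] unfolding nth a A2 low by simp
    moreover have "?Q F N - ?Q G N = 2 * (F N z x - G N z x)"
      using Q(1)[OF below(2) below(2) N] unfolding nth using G0[OF x] by simp
    ultimately have "Phi a F N z x - Phi a G N z x
        = 1 / z * (of_real rc * ((1 + (- 1) ^ N) * (F N z x - G N z x) * 2
            + 2 * ((1 + (- 1) ^ N) * (F N z x - G N z x)))) - 2 * (F N z x - G N z x)"
      unfolding Phi_fps lin by simp
    then show ?thesis by (cases "even N") (simp_all add: algebra_simps diff_divide_distrib)
  qed
  show "Phi a F (Suc N) z x - Phi a G (Suc N) z x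
      = (8 * of_real (a 1 x) / z - 2 * G 1 z x) * (F N z x - G N z x) - 2 * (F (Suc N) z x - G (Suc N) z x)"
    if N2: "N \<ge> 2" "even N"
  proof -
    have "?T F (Suc N) - ?T G (Suc N) = 8 * of_real (a 1 x) * (F N z x - G N z x)"
      using T(2)[OF below(1) below(1) N N2(1)] N2(2) unfolding nth a A2 A3 low by simp
    moreover have "?Q F (Suc N) - ?Q G (Suc N)
        = 2 * (F (Suc N) z x - G (Suc N) z x) + 2 * G 1 z x * (F N z x - G N z x)"
      using Q(2)[OF below(2) below(2) N N2(1)] unfolding nth using G0[OF x] by simp
    ultimately have "Phi a F (Suc N) z x - Phi a G (Suc N) z x = 1 / z * (8 * of_real (a 1 x) * (F N z x - G N z x))
        - (2 * (F (Suc N) z x - G (Suc N) z x) + 2 * G 1 z x * (F N z x - G N z x))"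
      unfolding Phi_fps lin by simp
    then show ?thesis by (simp add: algebra_simps diff_divide_distrib)
  qed
qed

end

text \<open>\<open>L f\<close> stands for the contour integral of V_\<lambda> f / w_c,
  \<open>\<phi>\<close> for the critical moment and \<open>\<chi>\<close> for the edge moment.
  \<open>L_power\<close> encodes the criticality conditions.\<close>

locale string_solution = double_scaling rc I u for rc I u +
  fixes a :: "nat \<Rightarrow> real \<Rightarrow> real" and W :: "nat \<Rightarrow> complex \<Rightarrow> real \<Rightarrow> complex"
    and R :: real and L :: "(complex \<Rightarrow> complex) \<Rightarrow> complex" and m :: nat and \<phi> \<chi> :: complex
  assumes a_smooth: "\<And>k. Cinf_on I (a k)" and a_0: "\<And>x. x \<in> I \<Longrightarrow> a 0 x = rc"
    and a_1: "\<And>x. x \<in> I \<Longrightarrow> a 1 x = u x"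
    and W_0: "\<And>z x. 4 * rc < norm z \<Longrightarrow> x \<in> I \<Longrightarrow> W 0 z x = 1"
    and Phi_W: "\<And>N z x. N \<ge> 1 \<Longrightarrow> 4 * rc < norm z \<Longrightarrow> x \<in> I \<Longrightarrow> Phi a W N z x = 0"
    and R: "4 * rc < R" and m: "m \<ge> 1"
    and L_cong: "\<And>f h. (\<And>z. norm z = R \<Longrightarrow> f z = h z) \<Longrightarrow> L f = L h"
    and L_add: "\<And>f h. continuous_on (sphere 0 R) f \<Longrightarrow> continuous_on (sphere 0 R) h
      \<Longrightarrow> L (\<lambda>z. f z + h z) = L f + L h"
    and L_scale: "\<And>f c. continuous_on (sphere 0 R) f \<Longrightarrow> L (\<lambda>z. c * f z) = c * L f"
    and L_power: "\<And>k. k < m \<Longrightarrow> L (\<lambda>z. (1 / z) ^ k) = 0"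
    and L_power_m: "L (\<lambda>z. (1 / z) ^ m) = - \<phi> / (4 * of_real rc)"
    and L_edge: "L (\<lambda>z. z / (z - 4 * of_real rc)) = \<chi>" and \<chi>: "\<chi> \<noteq> 0"
    and string: "\<And>N x. N \<ge> 1 \<Longrightarrow> x \<in> I \<Longrightarrow> L (\<lambda>z. z * W N z x) = (if N = 2 * m then of_real x else 0)"
begin

lemma sphere_outside: "norm z = R \<Longrightarrow> 4 * rc < norm (z :: complex)"
  using R by simp

lemma sphere_neq: "norm z = R \<Longrightarrow> z \<noteq> 0 \<and> z - 4 * of_real rc \<noteq> (0 :: complex)"
  using R rc by (auto simp: norm_mult)

lemma cont: "continuous_on (sphere 0 R) (\<lambda>z :: complex. (1 / z) ^ k)"
  "continuous_on (sphere 0 R) (\<lambda>z :: complex. z / (z - 4 * of_real rc))"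
  "continuous_on (sphere 0 R) (\<lambda>z :: complex. 1 / (z - 4 * of_real rc))"
  using sphere_neq by (auto intro!: continuous_intros)

lemma L_sum:
  assumes "finite A" "\<And>i. i \<in> A \<Longrightarrow> continuous_on (sphere 0 R) (f i)"
  shows "L (\<lambda>z. \<Sum>i\<in>A. c i * f i z) = (\<Sum>i\<in>A. c i * L (f i))"
  using assms
proof (induction A rule: finite_induct)
  case empty
  show ?case using L_scale[of "\<lambda>_. 0" 0] by simp
next
  case (insert j A)
  have "L (\<lambda>z. c j * f j z + (\<Sum>i\<in>A. c i * f i z)) = c j * L (f j) + L (\<lambda>z. \<Sum>i\<in>A. c i * f i z)"
    using insert.prems by (subst L_add) (auto intro!: continuous_intros L_scale)
  then show ?case using insert by simp
qed

text \<open>Splits the constant 1, whose moment vanishes, off z / (z - 4 rc).\<close>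

lemma L_edge': "L (\<lambda>z. 1 / (z - 4 * of_real rc)) = \<chi> / (4 * of_real rc)"
proof -
  have "\<chi> = L (\<lambda>z. 1 + 4 * of_real rc * (1 / (z - 4 * of_real rc)))"
    unfolding L_edge[symmetric]
  proof (rule L_cong)
    fix z :: complex assume "norm z = R"
    then have "z - 4 * of_real rc \<noteq> 0" using sphere_neq by blast
    then show "z / (z - 4 * of_real rc) = 1 + 4 * of_real rc * (1 / (z - 4 * of_real rc))"
      by (simp add: field_simps)
  qed
  also have "\<dots> = L (\<lambda>z. 1) + 4 * of_real rc * L (\<lambda>z. 1 / (z - 4 * of_real rc))"
  proof -
    have "L (\<lambda>z. 1 + 4 * of_real rc * (1 / (z - 4 * of_real rc)))
        = L (\<lambda>z. 1) + L (\<lambda>z. 4 * of_real rc * (1 / (z - 4 * of_real rc)))"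
      by (rule L_add) (intro continuous_on_const continuous_on_mult_left cont(3))+
    then show ?thesis unfolding L_scale[OF cont(3)] .
  qed
  also have "L (\<lambda>z. 1) = 0" using L_power[of 0] m by simp
  finally show ?thesis using rc by (simp add: field_simps)
qed

text \<open>\<open>F\<close> vanishes at infinity, so z F is a polynomial in 1/z of degree below
  \<open>d\<close>. Its moments vanish except for the power \<open>m\<close>, which is present only
  if \<open>d = Suc m\<close>. The summand \<open>k * f z\<close> makes room for a division
  remainder.\<close>

lemma L_rep:
  assumes "rep True F d P" "d \<le> Suc m" "x \<in> I" "continuous_on (sphere 0 R) f"
  shows "L (\<lambda>z. z * F z x + k * f z)
    = (if d = Suc m then - \<phi> / (4 * of_real rc) * of_real (deval P u x) else 0) + k * L f"
proof -
  obtain p where p: "rep_by p True F d P"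
    using assms(1) unfolding rep_def by blast
  note p = rep_byD[OF p]
  have sumsplit: "(\<Sum>i\<le>d. coeff (p x) i * y ^ i) = y * (\<Sum>i<d. coeff (p x) (Suc i) * y ^ i)" for y
  proof (cases d)
    case (Suc e)
    then show ?thesis
      using p(4)[OF assms(3)] unfolding Suc sum.atMost_Suc_shift lessThan_Suc_atMost
      by (simp add: sum_distrib_left mult_ac)
  qed (use p(4)[OF assms(3)] in simp)
  have "L (\<lambda>z. z * F z x + k * f z) = L (\<lambda>z. (\<Sum>i<d. coeff (p x) (Suc i) * (1 / z) ^ i) + k * f z)"
  proof (rule L_cong)
    fix z :: complex assume z: "norm z = R"
    have "z * F z x = z * (\<Sum>i\<le>d. coeff (p x) i * (1 / z) ^ i)"
      using p(5)[OF assms(3) sphere_outside[OF z]] poly_eq_sum_le[OF p(2)[OF assms(3)]] by simp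
    also have "\<dots> = (z * (1 / z)) * (\<Sum>i<d. coeff (p x) (Suc i) * (1 / z) ^ i)"
      unfolding sumsplit mult.assoc ..
    also have "z * (1 / z) = 1" using sphere_neq[OF z] by simp
    finally show "z * F z x + k * f z = (\<Sum>i<d. coeff (p x) (Suc i) * (1 / z) ^ i) + k * f z" by simp
  qed
  also have "\<dots> = L (\<lambda>z. \<Sum>i<d. coeff (p x) (Suc i) * (1 / z) ^ i) + k * L f"
    using assms(4) L_scale[OF assms(4)] cont(1) by (subst L_add) (auto intro!: continuous_on_sum continuous_on_mult_left)
  also have "L (\<lambda>z. \<Sum>i<d. coeff (p x) (Suc i) * (1 / z) ^ i) = (\<Sum>i<d. coeff (p x) (Suc i) * L (\<lambda>z. (1 / z) ^ i))"
    using cont(1) by (intro L_sum) auto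
  also have "\<dots> = (\<Sum>i<d. if i = m then coeff (p x) (Suc m) * (- \<phi> / (4 * of_real rc)) else 0)"
    using assms(2) by (intro sum.cong refl) (auto simp: L_power L_power_m)
  also have "\<dots> = (if d = Suc m then - \<phi> / (4 * of_real rc) * of_real (deval P u x) else 0)"
    using assms(2) p(3)[OF assms(3)] by (auto simp: sum.delta)
  finally show ?thesis .
qed

text \<open>W is compared with a trial sequence \<open>G\<close> that agrees below order
  \<open>N\<close> and has \<open>M\<close> there. By \<open>rep_Phi\<close> and
  \<open>rep_divide\<close>, dividing its defect by 1 - 4 rc / z yields the correction
  \<open>H\<close>; the remainder survives as a multiple of 1 / (z - 4 rc).\<close>

lemma even_step:
  assumes W: "\<And>k. k < N \<Longrightarrow> rep (k \<ge> 1) (W k) ((k + 1) div 2) (top_resolvent rc k)"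
    and N: "even N" "N \<ge> 2"
  shows "\<exists>Q \<kappa>. rep True Q (N div 2) (top_resolvent rc N) \<and>
    (\<forall>z :: complex. \<forall>x\<in>I. 4 * rc < norm z \<longrightarrow> W N z x = Q z x + \<kappa> x / (z - 4 * of_real rc))"
proof -
  define M where "M z x = of_real (deval (top_resolvent rc N) u x) * (1 / z) ^ (N div 2)" for z :: complex and x
  define G where "G k = (if k < N then W k else M)" for k
  have M: "rep True M (N div 2) (top_resolvent rc N)"
    using rep_monomial[of "N div 2" "top_resolvent rc N"] N by (simp add: M_def[abs_def])
  have G: "rep (k \<ge> 1) (G k) ((k + 1) div 2) (top_resolvent rc k)" if "k \<le> N" for k
    using W[of k] M that N by (cases "k < N") (auto simp: G_def)
  have "rep True (Phi a G N) (Suc (N div 2)) 0"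
    using N by (intro rep_Phi G a_smooth a_0 a_1) auto
  moreover have N2: "N div 2 \<ge> 1" using N by auto
  ultimately obtain H \<kappa> where H: "rep True H (N div 2) 0"
    "\<And>z x. 4 * rc < norm z \<Longrightarrow> x \<in> I \<Longrightarrow> Phi a G N z x = (1 - 4 * of_real rc / z) * H z x + \<kappa> x / z"
    using rep_divide[of "Phi a G N" "N div 2"] N2 by blast
  show ?thesis
  proof (intro exI[of _ "\<lambda>z x. M z x + of_real (1/2) * H z x"] exI[of _ "\<lambda>x. \<kappa> x / 2"] conjI allI ballI impI)
    show "rep True (\<lambda>z x. M z x + of_real (1/2) * H z x) (N div 2) (top_resolvent rc N)"
      using rep_add[OF M rep_scale[OF H(1), of "1/2"]] by simp
    fix z :: complex and x assume z: "4 * rc < norm z" and x: "x \<in> I"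
    have nz: "z \<noteq> 0" "z - 4 * of_real rc \<noteq> 0" using z rc by (auto simp: norm_mult)
    have "Phi a W N z x - Phi a G N z x = (8 * of_real rc / z - 2) * (W N z x - G N z x)"
      using Phi_diff(1)[of N W z G x a] W_0[OF z] a_0[OF x] N x by (simp add: G_def)
    then have "(1 - 4 * of_real rc / z) * H z x + \<kappa> x / z = 2 * (1 - 4 * of_real rc / z) * (W N z x - M z x)"
      using Phi_W[of N z x] N z x H(2)[OF z x] by (simp add: G_def algebra_simps)
    then show "W N z x = M z x + of_real (1/2) * H z x + \<kappa> x / 2 / (z - 4 * of_real rc)"
      using nz by (simp add: field_simps) algebra
  qed
qed

text \<open>Odd orders are solved without division. At even orders below \<open>2 * m\<close> the
  string equation and \<chi> \<noteq> 0 force the remainder of \<open>even_step\<close> to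
  vanish.\<close>

lemma W_rep: "N < 2 * m \<Longrightarrow> rep (N \<ge> 1) (W N) ((N + 1) div 2) (top_resolvent rc N)"
proof (induction N rule: less_induct)
  case (less N)
  then have IH: "rep (k \<ge> 1) (W k) ((k + 1) div 2) (top_resolvent rc k)" if "k < N" for k
    using that by simp
  consider "N = 0" | "even N" "N \<ge> 2" | "odd N" by (cases "N = 0"; cases "even N") (auto elim!: evenE)
  then show ?case
  proof cases
    case 1
    have "rep False (\<lambda>z x. of_real 1) 0 (top_resolvent rc 0)"
      by (rule rep_smooth(2)) (auto simp: Cinf_on_const top_resolvent_def)
    then show ?thesis using 1 W_0 by (auto elim!: rep_cong)
  next
    case 2
    obtain Q \<kappa> where Q: "rep True Q (N div 2) (top_resolvent rc N)"
      "\<And>z x. 4 * rc < norm z \<Longrightarrow> x \<in> I \<Longrightarrow> W N z x = Q z x + \<kappa> x / (z - 4 * of_real rc)"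
      using even_step[OF IH 2] by blast
    have "\<kappa> x = 0" if x: "x \<in> I" for x
    proof -
      \<comment> \<open>Here \<open>N div 2\<close> is less than \<open>m\<close>, so
        \<open>Q\<close> contributes nothing and only the remainder is left.\<close>
      have "0 = L (\<lambda>z. z * W N z x)"
        using string[of N x] 2 x less.prems by simp
      also have "\<dots> = L (\<lambda>z. z * Q z x + \<kappa> x * (z / (z - 4 * of_real rc)))"
        by (rule L_cong) (simp add: Q(2)[OF sphere_outside x] algebra_simps)
      also have "\<dots> = \<kappa> x * \<chi>"
        using L_rep[OF Q(1) _ x cont(2)] less.prems 2 by (auto simp: L_edge elim!: evenE)
      finally show ?thesis using \<chi> by simp
    qed
    then have "rep True (W N) (N div 2) (top_resolvent rc N)"
      using Q(2) by (intro rep_cong[OF Q(1)]) auto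
    then show ?thesis using 2 by simp
  next
    case 3
    define M where "M z x = of_real (deval (top_resolvent rc N) u x) * (1 / z) ^ ((N + 1) div 2)" for z :: complex and x
    define G where "G k = (if k < N then W k else M)" for k
    have N1: "N \<ge> 1" using 3 by (cases N) auto
    have M: "rep True M ((N + 1) div 2) (top_resolvent rc N)"
      using rep_monomial[of "(N + 1) div 2" "top_resolvent rc N"] N1 by (simp add: M_def[abs_def])
    have G: "rep (k \<ge> 1) (G k) ((k + 1) div 2) (top_resolvent rc k)" if "k \<le> N" for k
      using IH[of k] M that N1 by (cases "k < N") (auto simp: G_def)
    have "rep True (Phi a G N) (Suc (N div 2)) 0"
      using N1 by (intro rep_Phi G a_smooth a_0 a_1) auto
    moreover have d: "Suc (N div 2) = (N + 1) div 2" using 3 by (auto elim!: oddE)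
    ultimately have "rep True (\<lambda>z x. M z x + of_real (1 / 2) * Phi a G N z x) ((N + 1) div 2) (top_resolvent rc N)"
      using rep_add[OF M rep_scale[of True "Phi a G N" "(N + 1) div 2" 0 "1/2"]] by simp
    moreover have "W N z x = M z x + of_real (1 / 2) * Phi a G N z x" if z: "4 * rc < norm z" and x: "x \<in> I" for z x
    proof -
      have "Phi a W N z x - Phi a G N z x = - 2 * (W N z x - G N z x)"
        using Phi_diff(1)[of N W z G x a] W_0[OF z] a_0[OF x] N1 3 x by (simp add: G_def)
      then show ?thesis
        using Phi_W[OF N1 z x] by (simp add: G_def field_simps)
    qed
    ultimately show ?thesis using N1 by (auto elim!: rep_cong)
  qed
qed

text \<open>Order 1 is needed exactly in \<open>Phi_diff\<close> at order
  \<open>Suc (2 * m)\<close>; being of degree 1 without constant term, it is its own top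
  term.\<close>

lemma W_1:
  assumes "4 * rc < norm z" "x \<in> I"
  shows "W 1 z x = 2 * of_real (u x) / z"
proof -
  have "rep True (W 1) 1 (2 * dvar 0)"
    using W_rep[of 1] m by (simp add: top_resolvent_def)
  then obtain p where "rep_by p True (W 1) 1 (2 * dvar 0)"
    unfolding rep_def by blast
  note p = rep_byD[OF this]
  have "W 1 z x = (\<Sum>i\<le>1. coeff (p x) i * (1 / z) ^ i)"
    using p(5)[OF assms(2,1)] poly_eq_sum_le[OF p(2)[OF assms(2)]] by simp
  moreover have "deval (2 * dvar 0) u x = 2 * u x"
    using deval_dconst[of 2] by (simp add: deval_mult)
  ultimately show ?thesis
    using p(3,4)[OF assms(2)] by simp
qed

text \<open>Order \<open>2 * m\<close> fixes the remainder through
  \<open>\<kappa> x * \<chi> = x\<close>. At order \<open>Suc (2 * m)\<close> the string equation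
  has right-hand side 0 and balances \<phi> times the top coefficient against this remainder times
  u.\<close>

lemma string_equation:
  assumes x: "x \<in> I"
  shows "\<phi> * of_real (deval (rho rc m) u x) = 2 * of_real (u x) * of_real x"
proof -
  have W: "rep (k \<ge> 1) (W k) ((k + 1) div 2) (top_resolvent rc k)" if "k < 2 * m" for k
    using W_rep that by simp
  have m2: "even (2 * m)" "2 * m \<ge> 2" using m by auto
  obtain Q \<kappa> where Q: "rep True Q (2 * m div 2) (top_resolvent rc (2 * m))"
    "\<And>z x. 4 * rc < norm z \<Longrightarrow> x \<in> I \<Longrightarrow> W (2 * m) z x = Q z x + \<kappa> x / (z - 4 * of_real rc)"
    using even_step[OF W m2] by blast
  have "of_real x = L (\<lambda>z. z * W (2 * m) z x)"
    using string[of "2 * m" x] m x by simp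
  also have "\<dots> = L (\<lambda>z. z * Q z x + \<kappa> x * (z / (z - 4 * of_real rc)))"
  proof (rule L_cong)
    fix z :: complex assume "norm z = R"
    then show "z * W (2 * m) z x = z * Q z x + \<kappa> x * (z / (z - 4 * of_real rc))"
      unfolding Q(2)[OF sphere_outside[OF \<open>norm z = R\<close>] x] by (simp add: distrib_left mult.commute[of z "\<kappa> x"])
  qed
  also have "\<dots> = \<kappa> x * \<chi>"
    using L_rep[OF Q(1) _ x cont(2)] by (simp add: L_edge)
  finally have \<kappa>: "\<kappa> x * \<chi> = of_real x" by simp
  define M where "M z x = of_real (deval (rho rc m) u x) * (1 / z) ^ Suc m" for z :: complex and x
  \<comment> \<open>At order \<open>2 * m\<close> the trial value is only the polynomial part
    \<open>Q\<close>; the remainder left out comes back below as \<open>\<delta>\<close>.\<close>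
  define G where "G k = (if k < 2 * m then W k else if k = 2 * m then Q else M)" for k
  have M: "rep True M (Suc m) (rho rc m)"
    using rep_monomial[of "Suc m" "rho rc m"] by (simp add: M_def[abs_def])
  have G: "rep (k \<ge> 1) (G k) ((k + 1) div 2) (top_resolvent rc k)" if k: "k \<le> Suc (2 * m)" for k
  proof -
    consider "k < 2 * m" | "k = 2 * m" | "k = Suc (2 * m)" using k by linarith
    then show ?thesis
      by cases (use W[of k] Q(1) M m in \<open>simp_all add: G_def top_resolvent_def\<close>)
  qed
  have "rep True (Phi a G (Suc (2 * m))) (Suc m) 0"
    using rep_Phi[of "Suc (2 * m)" G a] G a_smooth a_0 a_1 by simp
  from rep_add[OF M rep_scale[OF this, of "1/2"]]
  have Q': "rep True (\<lambda>z x. M z x + of_real (1/2) * Phi a G (Suc (2 * m)) z x) (Suc m) (rho rc m)"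
    by simp
  have "0 = L (\<lambda>z. z * W (Suc (2 * m)) z x)"
    using string[of "Suc (2 * m)" x] x by simp
  also have "\<dots> = L (\<lambda>z. z * (M z x + of_real (1/2) * Phi a G (Suc (2 * m)) z x)
      + (2 * of_real (u x) * \<kappa> x) * (1 / (z - 4 * of_real rc)))"
  proof (rule L_cong)
    fix z :: complex assume zR: "norm z = R"
    note z = sphere_outside[OF zR]
    have nz: "z \<noteq> 0" "z - 4 * of_real rc \<noteq> 0" using sphere_neq[OF zR] by auto
    define \<delta> where "\<delta> = \<kappa> x / (z - 4 * of_real rc)"
    have e: "Phi a W (Suc (2 * m)) z x - Phi a G (Suc (2 * m)) z x
      = (8 * of_real (a 1 x) / z - 2 * G 1 z x) * (W (2 * m) z x - G (2 * m) z x)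
        - 2 * (W (Suc (2 * m)) z x - G (Suc (2 * m)) z x)"
      using W_0[OF z] m by (intro Phi_diff(2) x a_0) (auto simp: G_def)
    have e1: "Phi a W (Suc (2 * m)) z x = 0" by (rule Phi_W[OF _ z x]) simp
    have e2: "G 1 z x = 2 * (of_real (u x) / z)"
      using W_1[OF z x] m by (simp add: G_def)
    have e3: "W (2 * m) z x - G (2 * m) z x = \<delta>"
      using Q(2)[OF z x] by (simp add: G_def \<delta>_def)
    have e4: "G (Suc (2 * m)) z x = M z x" by (simp add: G_def)
    \<comment> \<open>The remainder enters with 8 u / z from the triple product and - 4 u / z from
      the square, the latter by \<open>W_1\<close>; halving leaves 2 u / z.\<close>
    have lin: "w = M' + of_real (1/2) * p + 2 * q * \<delta>"
      if "0 - p = (8 * q - 2 * (2 * q)) * \<delta> - 2 * (w - M')" for w M' p q :: complex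
      using that by (simp add: field_simps)
    have "0 - Phi a G (Suc (2 * m)) z x = (8 * (of_real (u x) / z) - 2 * (2 * (of_real (u x) / z))) * \<delta>
        - 2 * (W (Suc (2 * m)) z x - M z x)"
      using e unfolding e1 e2 e3 e4 a_1[OF x] by simp
    from lin[OF this]
    have "W (Suc (2 * m)) z x = M z x + of_real (1/2) * Phi a G (Suc (2 * m)) z x + 2 * of_real (u x) / z * \<delta>"
      by simp
    then have "z * W (Suc (2 * m)) z x = z * (M z x + of_real (1/2) * Phi a G (Suc (2 * m)) z x)
        + z * (2 * of_real (u x) / z * \<delta>)"
      by (simp only: distrib_left)
    also have "z * (2 * of_real (u x) / z * \<delta>) = (2 * of_real (u x) * \<kappa> x) * (1 / (z - 4 * of_real rc))"
      using nz by (simp add: \<delta>_def)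
    finally show "z * W (Suc (2 * m)) z x = z * (M z x + of_real (1/2) * Phi a G (Suc (2 * m)) z x)
      + (2 * of_real (u x) * \<kappa> x) * (1 / (z - 4 * of_real rc))" .
  qed
  also have "\<dots> = - \<phi> / (4 * of_real rc) * of_real (deval (rho rc m) u x)
      + 2 * of_real (u x) * \<kappa> x * (\<chi> / (4 * of_real rc))"
    using L_rep[OF Q' _ x cont(3)] by (simp add: L_edge')
  also have "2 * of_real (u x) * \<kappa> x * (\<chi> / (4 * of_real rc)) = 2 * of_real (u x) * of_real x / (4 * of_real rc)"
    using \<kappa> by (simp add: mult.assoc)
  finally show ?thesis
    using rc by (simp add: field_simps)
qed

end

subsection \<open>The contour integral and the main theorem\<close>

text \<open>The argument of \<open>csqrt\<close> lies in the open unit disc about 1 and so avoids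
  the branch cut; this gives the continuity of \<open>wc\<close>.\<close>

lemma one_minus_notin_nonpos:
  fixes z :: complex
  assumes "4 * r < norm z" "r > 0"
  shows "1 - 4 * of_real r / z \<notin> \<real>\<^sub>\<le>\<^sub>0"
proof -
  have "norm (4 * of_real r / z) < 1"
    using assms by (simp add: norm_divide norm_mult divide_less_eq)
  then have "Re (4 * of_real r / z) < 1"
    using complex_Re_le_cmod[of "4 * of_real r / z"] by linarith
  then show ?thesis by (simp add: complex_nonpos_Reals_iff)
qed

lemma wc_outside:
  assumes "4 * r < norm z" "r > 0"
  shows "wc r z ^ 2 = z * (z - 4 * of_real r)" "z \<noteq> 0" "z - 4 * of_real r \<noteq> 0" "wc r z \<noteq> 0"
proof -
  show nz: "z \<noteq> 0" "z - 4 * of_real r \<noteq> 0" using assms by (auto simp: norm_mult)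
  show sq: "wc r z ^ 2 = z * (z - 4 * of_real r)"
  proof -
    have "wc r z ^ 2 = z ^ 2 * (1 - 4 * of_real r / z)"
      by (simp add: wc_def power_mult_distrib)
    also have "\<dots> = z * (z - 4 * of_real r)"
      using nz(1) by (simp add: field_simps power2_eq_square)
    finally show ?thesis .
  qed
  show "wc r z \<noteq> 0" using sq nz by auto
qed

lemma continuous_on_wc:
  assumes "r > 0" "R > 4 * r"
  shows "continuous_on (sphere 0 R) (wc r)"
proof -
  have out: "4 * r < norm z" if "z \<in> sphere 0 R" for z :: complex using that assms by simp
  have "z \<noteq> 0" if "z \<in> sphere 0 R" for z :: complex using out[OF that] assms by auto
  then have "continuous_on (sphere 0 R) (\<lambda>z :: complex. 1 - 4 * of_real r / z)"
    by (auto intro!: continuous_intros)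
  moreover have "(\<lambda>z :: complex. 1 - 4 * of_real r / z) ` sphere 0 R \<subseteq> - \<real>\<^sub>\<le>\<^sub>0"
    using one_minus_notin_nonpos[OF out] assms by auto
  ultimately have "continuous_on (sphere 0 R) (\<lambda>z. csqrt (1 - 4 * of_real r / z))"
    using continuous_on_compose2[OF continuous_on_csqrt] by blast
  then show ?thesis
    unfolding wc_def[abs_def] by (intro continuous_on_mult continuous_on_id)
qed

lemma continuous_on_deriv_Vpot: "continuous_on S (deriv (Vpot g p))"
proof -
  have "Vpot g p holomorphic_on UNIV"
    unfolding Vpot_def[abs_def] by (intro holomorphic_intros)
  then have "deriv (Vpot g p) holomorphic_on UNIV"
    by (intro holomorphic_deriv) auto
  then show ?thesis
    using continuous_on_subset holomorphic_on_imp_continuous_on by blast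
qed

section \<open>Linearity of the contour integral\<close>

lemma cint_cong: "R > 0 \<Longrightarrow> (\<And>z. norm z = R \<Longrightarrow> f z = h z) \<Longrightarrow> cint R f = cint R h"
  unfolding cint_def by (subst contour_integral_eq[of _ f h]) auto

lemma cint_add:
  assumes "R > 0" "continuous_on (sphere 0 R) f" "continuous_on (sphere 0 R) h"
  shows "cint R (\<lambda>z. f z + h z) = cint R f + cint R h"
  unfolding cint_def using assms
  by (subst contour_integral_add)
     (auto intro!: contour_integrable_continuous_circlepath simp: add_divide_distrib)

lemma cint_scale:
  assumes "R > 0" "continuous_on (sphere 0 R) f"
  shows "cint R (\<lambda>z. c * f z) = c * cint R f"
  unfolding cint_def using assms
  by (subst contour_integral_lmul)
     (auto intro!: contour_integrable_continuous_circlepath)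

theorem theorem3:
  fixes p m :: nat and g :: "nat \<Rightarrow> real" and rc R :: real and I :: "real set"
    and a :: "nat \<Rightarrow> real \<Rightarrow> real"
    and VV :: "nat \<Rightarrow> complex \<Rightarrow> real \<Rightarrow> complex"
  assumes hp: "p \<ge> 1" and hg: "g (2 * p) > 0"
    and hrc: "rc > 0" and hR: "R > 4 * rc"
    and hm: "m \<ge> 1"
    and c0: "cint R (\<lambda>z. deriv (Vpot g p) z / wc rc z) = 0"
    and ck: "\<And>k. 1 \<le> k \<Longrightarrow> k \<le> m - 1 \<Longrightarrow>
       cint R (\<lambda>z. (z - 4 * of_real rc) ^ (k + 1) * deriv (Vpot g p) z / wc rc z ^ (2 * k + 1)) = 0"
    and cm: "cint R (\<lambda>z. (z - 4 * of_real rc) ^ (m + 1) * deriv (Vpot g p) z / wc rc z ^ (2 * m + 1)) \<noteq> 0"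
    and c2: "cint R (\<lambda>z. z ^ 2 * deriv (Vpot g p) z / wc rc z ^ 3) \<noteq> 0"
    and hI: "open I" "is_interval I" "I \<noteq> {}"
    and ha0: "\<And>x. x \<in> I \<Longrightarrow> a 0 x = rc"
    and ha: "\<And>k. k \<ge> 1 \<Longrightarrow> Cinf_on I (a k)"
    and hVhol: "\<And>k x. x \<in> I \<Longrightarrow> (\<lambda>z. VV k z x) holomorphic_on {z. 4 * rc < norm z}"
    and hVsm: "\<And>k z. 4 * rc < norm z \<Longrightarrow> Cinf_on I (VV k z)"
    and hV0: "\<And>z x. 4 * rc < norm z \<Longrightarrow> x \<in> I \<Longrightarrow> VV 0 z x = z / wc rc z"
    and heq: "\<And>z x. 4 * rc < norm z \<Longrightarrow> x \<in> I \<Longrightarrow>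
       Abs_fps (\<lambda>k. of_real (a k x))
         * (Abs_fps (\<lambda>k. VV k z x) + Abs_fps (\<lambda>N. shift_coeff (-1) (-1) (\<lambda>k. VV k z) N x))
         * (Abs_fps (\<lambda>k. VV k z x) + Abs_fps (\<lambda>N. shift_coeff (-1) 1 (\<lambda>k. VV k z) N x))
       = fps_const z * (Abs_fps (\<lambda>k. VV k z x) ^ 2 - 1)"
    and hstr: "\<And>x. x \<in> I \<Longrightarrow>
       Abs_fps (\<lambda>N. cint R (\<lambda>z. deriv (Vpot g p) z * VV N z x))
       = fps_const (cint R (\<lambda>z. z * deriv (Vpot g p) z / wc rc z))
         + fps_const (of_real x) * fps_X ^ (2 * m)"
  shows "\<forall>x\<in>I. 2 * rc * cint R (\<lambda>z. (z - 4 * of_real rc) ^ (m + 1) * deriv (Vpot g p) z / wc rc z ^ (2 * m + 1))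
                  * of_real (deval (Rpoly rc m) (a 1) x) + of_real x * of_real (a 1 x) = 0"
proof -
  have R0: "R > 0" using hR hrc by simp
  have out: "4 * rc < norm z" if "norm z = R" for z :: complex using that hR by simp
  note w = wc_outside[OF _ hrc]
  \<comment> \<open>The contour conditions and the string equation all become moments for this one
    weight.\<close>
  define L where "L f = cint R (\<lambda>z. deriv (Vpot g p) z / wc rc z * f z)" for f
  define \<phi> where "\<phi> = cint R (\<lambda>z. (z - 4 * of_real rc) ^ (m + 1) * deriv (Vpot g p) z / wc rc z ^ (2 * m + 1))"
  define \<chi> where "\<chi> = cint R (\<lambda>z. z ^ 2 * deriv (Vpot g p) z / wc rc z ^ 3)"
  have cont: "continuous_on (sphere 0 R) (\<lambda>z. deriv (Vpot g p) z / wc rc z)"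
    by (intro continuous_on_divide continuous_on_deriv_Vpot continuous_on_wc hrc hR ballI w(4)) (simp add: hR)
  have L_cong: "L f = L h" if "\<And>z. norm z = R \<Longrightarrow> f z = h z" for f h
    unfolding L_def using that by (intro cint_cong[OF R0]) simp
  have L_add: "L (\<lambda>z. f z + h z) = L f + L h"
    if "continuous_on (sphere 0 R) f" "continuous_on (sphere 0 R) h" for f h
    using cint_add[OF R0 continuous_on_mult[OF cont that(1)] continuous_on_mult[OF cont that(2)]]
    by (simp add: L_def distrib_left)
  have L_scale: "L (\<lambda>z. c * f z) = c * L f" if "continuous_on (sphere 0 R) f" for f c
    using cint_scale[OF R0 continuous_on_mult[OF cont that], of c] by (simp add: L_def mult_ac)
  have cp: "continuous_on (sphere 0 R) (\<lambda>z :: complex. (1 / z) ^ k)" for k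
    using w(2)[OF out] by (auto intro!: continuous_intros)
  \<comment> \<open>By w_c^2 = z (z - 4 rc), the integrand is the weight times (z - 4 rc) / z^(k+1),
    so each condition links two consecutive moments of 1/z.\<close>
  have moment: "cint R (\<lambda>z. (z - 4 * of_real rc) ^ (Suc k + 1) * deriv (Vpot g p) z / wc rc z ^ (2 * Suc k + 1))
      = L (\<lambda>z. (1 / z) ^ k) - 4 * of_real rc * L (\<lambda>z. (1 / z) ^ Suc k)" for k
  proof -
    have "cint R (\<lambda>z. (z - 4 * of_real rc) ^ (Suc k + 1) * deriv (Vpot g p) z / wc rc z ^ (2 * Suc k + 1))
        = L (\<lambda>z. (1 / z) ^ k + (- 4 * of_real rc) * (1 / z) ^ Suc k)"
      unfolding L_def
    proof (rule cint_cong[OF R0])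
      fix z :: complex assume "norm z = R"
      note w = w[OF out[OF this]]
      have e: "wc rc z ^ (2 * Suc k + 1) = wc rc z * (z ^ Suc k * (z - 4 * of_real rc) ^ Suc k)"
        by (simp only: Suc_eq_plus1[symmetric] power_Suc[of _ "2 * _"] power_mult w(1) power_mult_distrib)
      have "(z - 4 * of_real rc) ^ (Suc k + 1) * deriv (Vpot g p) z / wc rc z ^ (2 * Suc k + 1)
          = deriv (Vpot g p) z / wc rc z * ((z - 4 * of_real rc) / z ^ Suc k)"
        unfolding e using w by (simp add: field_simps)
      also have "(z - 4 * of_real rc) / z ^ Suc k = (1 / z) ^ k + (- 4 * of_real rc) * (1 / z) ^ Suc k"
        using w(2) by (simp add: field_simps power_one_over)
      finally show "(z - 4 * of_real rc) ^ (Suc k + 1) * deriv (Vpot g p) z / wc rc z ^ (2 * Suc k + 1)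
        = deriv (Vpot g p) z / wc rc z * ((1 / z) ^ k + (- 4 * of_real rc) * (1 / z) ^ Suc k)" .
    qed
    also have "\<dots> = L (\<lambda>z. (1 / z) ^ k) + L (\<lambda>z. (- 4 * of_real rc) * (1 / z) ^ Suc k)"
      by (intro L_add cp continuous_on_mult_left)
    also have "L (\<lambda>z. (- 4 * of_real rc) * (1 / z) ^ Suc k) = (- 4 * of_real rc) * L (\<lambda>z. (1 / z) ^ Suc k)"
      by (rule L_scale[OF cp])
    finally show ?thesis by simp
  qed
  \<comment> \<open>Starting from \<open>c0\<close>, the conditions \<open>ck\<close> carry the
    vanishing up one power at a time.\<close>
  have L_power: "L (\<lambda>z. (1 / z) ^ k) = 0" if "k < m" for k
    using that
  proof (induction k)
    case 0
    then show ?case using c0 by (simp add: L_def)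
  next
    case (Suc k)
    then show ?case using moment[of k] ck[of "Suc k"] hrc by simp
  qed
  have L_power_m: "L (\<lambda>z. (1 / z) ^ m) = - \<phi> / (4 * of_real rc)"
  proof -
    obtain k where k: "m = Suc k" using hm by (cases m) auto
    have "\<phi> = L (\<lambda>z. (1 / z) ^ k) - 4 * of_real rc * L (\<lambda>z. (1 / z) ^ m)"
      unfolding \<phi>_def k by (rule moment)
    then show ?thesis
      using L_power[of k] hrc by (simp add: k)
  qed
  have L_edge: "L (\<lambda>z. z / (z - 4 * of_real rc)) = \<chi>"
    unfolding L_def \<chi>_def
  proof (rule cint_cong[OF R0])
    fix z :: complex assume "norm z = R"
    note w = w[OF out[OF this]]
    have e: "wc rc z ^ 3 = wc rc z * (z * (z - 4 * of_real rc))"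
      unfolding w(1)[symmetric] by (simp add: power3_eq_cube power2_eq_square)
    have "D / v * (z / d) = z ^ 2 * D / (v * (z * d))" if "v \<noteq> 0" "d \<noteq> 0" for D v d :: complex
      using that w(2) by (simp add: field_simps power2_eq_square)
    from this[OF w(4,3)]
    show "deriv (Vpot g p) z / wc rc z * (z / (z - 4 * of_real rc)) = z ^ 2 * deriv (Vpot g p) z / wc rc z ^ 3"
      unfolding e .
  qed
  \<comment> \<open>Dividing by the leading order z / w_c normalises \<open>W 0\<close> to
    1.\<close>
  define W where "W k z x = VV k z x * (wc rc z / z)" for k z x
  have a_smooth: "Cinf_on I (a k)" for k
  proof (cases k)
    case 0
    then show ?thesis
      using Cinf_on_cong[OF hI(1) _ Cinf_on_const[of I rc], of "a 0"] ha0 by simp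
  qed (simp add: ha)
  interpret double_scaling rc I "a 1"
    by unfold_locales (use hrc hI(1) a_smooth in auto)
  have Phi_W: "Phi a W N z x = 0" if N: "N \<ge> 1" and z: "4 * rc < norm z" and x: "x \<in> I" for N z x
  proof -
    let ?V = "Abs_fps (\<lambda>k. VV k z x)"
    define e where "e = wc rc z / z"
    \<comment> \<open>The squared factor turns the constant - 1 of the quadratic equation into - (1
      - 4 rc / z), which is invisible at orders \<open>N \<ge> 1\<close>.\<close>
    have e2: "fps_const e * fps_const e = fps_const (1 - 4 * of_real rc / z)"
      using w(1,2)[OF z] by (simp add: e_def field_simps power2_eq_square)
    have shift: "shift_coeff (- 1) c (\<lambda>k. W k z) n x = e * shift_coeff (- 1) c (\<lambda>k. VV k z) n x" for c n
    proof -
      have "dnx j (W i z) x = dnx j (VV i z) x * e" for i j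
        unfolding W_def[abs_def] e_def[symmetric]
        by (rule dnx_linear[OF hI(1) bounded_linear_mult_left hVsm[OF z] x])
      then show ?thesis
        unfolding shift_coeff_def by (simp add: sum_distrib_left mult_ac)
    qed
    have W: "seq_fps W z x = fps_const e * ?V"
      by (rule fps_ext) (simp add: seq_fps_def W_def e_def)
    have A: "seq_fps (sym_sum c W) z x = fps_const e * (?V + Abs_fps (\<lambda>N. shift_coeff (- 1) c (\<lambda>k. VV k z) N x))" for c
      by (rule fps_ext) (simp add: seq_fps_def sym_sum_def shift distrib_left, simp add: W_def e_def)
    have "coeff_fps a x * seq_fps (sym_sum (-1) W) z x * seq_fps (sym_sum 1 W) z x
      = fps_const e * fps_const e * (Abs_fps (\<lambda>k. of_real (a k x))
         * (?V + Abs_fps (\<lambda>N. shift_coeff (-1) (-1) (\<lambda>k. VV k z) N x))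
         * (?V + Abs_fps (\<lambda>N. shift_coeff (-1) 1 (\<lambda>k. VV k z) N x)))"
      unfolding A coeff_fps_def by (simp only: mult_ac)
    also have "\<dots> = fps_const z * (seq_fps W z x * seq_fps W z x) - fps_const z * (fps_const e * fps_const e)"
      unfolding heq[OF z x] W by (simp add: algebra_simps power2_eq_square del: fps_const_mult)
    finally have "(coeff_fps a x * seq_fps (sym_sum (-1) W) z x * seq_fps (sym_sum 1 W) z x) $ N = z * (seq_fps W z x * seq_fps W z x) $ N"
      unfolding e2 using N by simp
    then show ?thesis
      unfolding Phi_fps using w(2)[OF z] by simp
  qed
  interpret string_solution rc I "a 1" a W R L m \<phi> \<chi>
  proof unfold_locales
    show "W 0 z x = 1" if "4 * rc < norm z" "x \<in> I" for z x
      using hV0[OF that] w[OF that(1)] by (simp add: W_def)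
    show "\<chi> \<noteq> 0" using c2 by (simp add: \<chi>_def)
    show "L (\<lambda>z. z * W N z x) = (if N = 2 * m then of_real x else 0)" if N: "N \<ge> 1" and x: "x \<in> I" for N x
    proof -
      have "L (\<lambda>z. z * W N z x) = cint R (\<lambda>z. deriv (Vpot g p) z * VV N z x)"
        unfolding L_def W_def
      proof (rule cint_cong[OF R0])
        fix z :: complex assume "norm z = R"
        then show "deriv (Vpot g p) z / wc rc z * (z * (VV N z x * (wc rc z / z))) = deriv (Vpot g p) z * VV N z x"
          using w(2,4)[OF out] by simp
      qed
      also have "\<dots> = (if N = 2 * m then of_real x else 0)"
        using arg_cong[OF hstr[OF x], of "\<lambda>F. F $ N"] N by (simp add: fps_X_power_nth)
      finally show ?thesis .
    qed
  qed (rule a_smooth ha0 refl hR hm Phi_W L_cong L_add L_scale L_power L_power_m L_edge; assumption)+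
  show ?thesis
  proof
    fix x assume x: "x \<in> I"
    have "of_real (deval (Rpoly rc m) (a 1) x) = - of_real (deval (rho rc m) (a 1) x) / (4 * complex_of_real rc)"
      by (simp add: Rpoly_eq[OF hrc] deval_mult)
    then have "2 * rc * \<phi> * of_real (deval (Rpoly rc m) (a 1) x) = - (\<phi> * of_real (deval (rho rc m) (a 1) x)) / 2"
      using hrc by (simp add: field_simps)
    then show "2 * rc * cint R (\<lambda>z. (z - 4 * of_real rc) ^ (m + 1) * deriv (Vpot g p) z / wc rc z ^ (2 * m + 1))
                  * of_real (deval (Rpoly rc m) (a 1) x) + of_real x * of_real (a 1 x) = 0"
      unfolding string_equation[OF x] \<phi>_def[symmetric] by simp
  qed
qed

end
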